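(* Let $\Gamma$ be a finitely generated group acting continuously on a compact metric space $Y$. Assume that the action $\Gamma\curvearrowright Y$ is free and linearisable in a Hilbert space, and that $\Gamma$ is a-T-menable. Then the warped cone $\mathcal{O}_\Gamma Y$ admits a fibred coarse embedding into a Hilbert space.
   Context: Warped cone. Let $\Gamma$ be a group with a fixed finite generating set $S$, acting continuously on a compact metric space $(Y,d)$ with $\operatorname{diam}(Y)>0$. The infinite cone $\mathcal{O}Y$ is $(0,\infty)\times Y$ with the metric $d((r,y),(r',y')) = |r-r'|\cdot\operatorname{diam}(Y)+\min(r,r')\cdot d(y,y')$ and the action $\gamma(r,y)=(r,\gamma y)$. The warped cone $\mathcal{O}_\Gamma Y$ is $\mathcal{O}Y$ equipped with the warped metric $d_\Gamma$: the largest metric on $\mathcal{O}Y$ such that $d_\Gamma\le d$ and $d_\Gamma(x,sx)\le 1$ for all $x\in\mathcal{O}Y$, $s\in S$. Linearisable. An action $\Gamma\curvearrowright Y$ is linearisable in a Banach space $E$ if there exist an isometric (linear) representation of $\Gamma$ on $E$ and a $\Gamma$-equivariant bi-Lipschitz embedding $Y\to E$. A-T-menable. A finitely generated group $\Gamma$ is a-T-menable (has the Haagerup property) if it admits an isometric action by affine maps on a Hilbert space that is metrically proper, i.e. for every orbit map the inverse images of balls are finite. Fibred coarse embedding. A metric space $X$ admits a fibred coarse embedding into a normed space $E$ if there exist: a field $\{E_x\}_{x\in X}$ of isometric copies of $E$; a sequence of sections $f_n\colon X\to\bigsqcup_{x\in X}E_x$ (so $f_n(x)\in E_x$); and non-decreasing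 unbounded functions $\rho_\pm\colon[0,\infty)\to[0,\infty)$, such that for every $n\in\mathbb{N}$ there exist a bounded subset $K_n\subseteq X$ and, for every $x\in X\setminus K_n$, a trivialisation $\tau_n^x\colon\bigsqcup_{y\in B(x,n)}E_y\to B(x,n)\times E$ with $\tau_n^x(E_y)=\{y\}\times E$, such that, writing $t_n^x$ for the composition of $\tau_n^x$ with the projection onto $E$, the restriction of $t_n^x$ to each $E_y$, $y\in B(x,n)$, is an isometry onto $E$, and: (i) for all $y,y'\in B(x,n)$: $\rho_-(d(y,y'))\le\|t_n^x(f_n(y))-t_n^x(f_n(y'))\|\le\rho_+(d(y,y'))$; (ii) for all $x,x'\in X\setminus K_n$ such that $I=B(x,n)\cap B(x',n)$ is non-empty, there is an isometry $t_n^{x,x'}\colon E\to E$ such that $\mathrm{id}\times t_n^{x,x'}\colon I\times E\to I\times E$ equals the composition $\tau_n^x\circ(\tau_n^{x'})^{-1}$. Free means that $\gamma y=y$ for some $y\in Y$ implies $\gamma=e$. *)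

theory Defs
  imports "HOL-Analysis.Analysis" "HOL-Algebra.Group_Action" "HOL-Algebra.Generated_Groups"
    "HOL-Algebra.Module"
begin

section \<open>Group actions\<close>

definition continuous_action ::
  "('g, 'm) monoid_scheme \<Rightarrow> 'y::metric_space set \<Rightarrow> ('g \<Rightarrow> 'y \<Rightarrow> 'y) \<Rightarrow> bool" where
  "continuous_action G Y \<phi> \<longleftrightarrow>
     group_action G Y \<phi> \<and> (\<forall>g\<in>carrier G. continuous_on Y (\<phi> g))"

definition free_action ::
  "('g, 'm) monoid_scheme \<Rightarrow> 'y set \<Rightarrow> ('g \<Rightarrow> 'y \<Rightarrow> 'y) \<Rightarrow> bool" where
  "free_action G Y \<phi> \<longleftrightarrow>
     (\<forall>g\<in>carrier G. (\<exists>y\<in>Y. \<phi> g y = y) \<longrightarrow> g = \<one>\<^bsub>G\<^esub>)"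

definition isometric_representation ::
  "('g, 'm) monoid_scheme \<Rightarrow> ('g \<Rightarrow> 'e::real_normed_vector \<Rightarrow> 'e) \<Rightarrow> bool" where
  "isometric_representation G \<pi> \<longleftrightarrow>
     group_action G UNIV \<pi> \<and> (\<forall>g\<in>carrier G. linear (\<pi> g) \<and> (\<forall>v. norm (\<pi> g v) = norm v))"

definition bi_Lipschitz_embedding ::
  "'y::metric_space set \<Rightarrow> ('y \<Rightarrow> 'e::metric_space) \<Rightarrow> bool" where
  "bi_Lipschitz_embedding Y \<iota> \<longleftrightarrow>
     (\<exists>c>0. \<exists>C>0. \<forall>y\<in>Y. \<forall>y'\<in>Y.
        c * dist y y' \<le> dist (\<iota> y) (\<iota> y') \<and> dist (\<iota> y) (\<iota> y') \<le> C * dist y y')"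

definition linearisable ::
  "('g, 'm) monoid_scheme \<Rightarrow> 'y::metric_space set \<Rightarrow> ('g \<Rightarrow> 'y \<Rightarrow> 'y) \<Rightarrow> 'e::banach itself \<Rightarrow> bool"
  where
  "linearisable G Y \<phi> (_ :: 'e itself) \<longleftrightarrow>
     (\<exists>(\<pi> :: 'g \<Rightarrow> 'e \<Rightarrow> 'e) (\<iota> :: 'y \<Rightarrow> 'e).
        isometric_representation G \<pi> \<and> bi_Lipschitz_embedding Y \<iota> \<and>
        (\<forall>g\<in>carrier G. \<forall>y\<in>Y. \<iota> (\<phi> g y) = \<pi> g (\<iota> y)))"

definition isometric_affine_action ::
  "('g, 'm) monoid_scheme \<Rightarrow> ('g \<Rightarrow> 'e::real_normed_vector \<Rightarrow> 'e) \<Rightarrow> bool" where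
  "isometric_affine_action G \<alpha> \<longleftrightarrow>
     group_action G UNIV \<alpha> \<and>
     (\<forall>g\<in>carrier G. (\<exists>L b. linear L \<and> (\<forall>v. \<alpha> g v = L v + b)) \<and>
        (\<forall>v w. dist (\<alpha> g v) (\<alpha> g w) = dist v w))"

definition a_T_menable ::
  "('g, 'm) monoid_scheme \<Rightarrow> 'e::{real_inner,banach} itself \<Rightarrow> bool" where
  "a_T_menable G (_ :: 'e itself) \<longleftrightarrow>
     (\<exists>\<alpha> :: 'g \<Rightarrow> 'e \<Rightarrow> 'e. isometric_affine_action G \<alpha> \<and>
        (\<forall>v w r. finite {g \<in> carrier G. \<alpha> g v \<in> cball w r}))"

section \<open>Warped cones\<close>

definition infinite_cone :: "'y set \<Rightarrow> (real \<times> 'y) set" where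
  "infinite_cone Y = {0<..} \<times> Y"

definition cone_dist ::
  "'y::metric_space set \<Rightarrow> real \<times> 'y \<Rightarrow> real \<times> 'y \<Rightarrow> real" where
  "cone_dist Y p q =
     \<bar>fst p - fst q\<bar> * diameter Y + min (fst p) (fst q) * dist (snd p) (snd q)"

definition cone_action :: "('g \<Rightarrow> 'y \<Rightarrow> 'y) \<Rightarrow> 'g \<Rightarrow> real \<times> 'y \<Rightarrow> real \<times> 'y" where
  "cone_action \<phi> g p = (fst p, \<phi> g (snd p))"

text \<open>A distance function is a total function on the type \<open>real \<times> 'y\<close>. Normalising it to
  vanish off the cone makes the pointwise order on functions the order on metrics on the
  cone.\<close>

definition warping_metric ::
  "'g set \<Rightarrow> 'y::metric_space set \<Rightarrow> ('g \<Rightarrow> 'y \<Rightarrow> 'y) \<Rightarrow> (real \<times> 'y \<Rightarrow> real \<times> 'y \<Rightarrow> real) \<Rightarrow> bool"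
  where
  "warping_metric S Y \<phi> m \<longleftrightarrow>
     Metric_space (infinite_cone Y) m \<and>
     (\<forall>p q. p \<notin> infinite_cone Y \<or> q \<notin> infinite_cone Y \<longrightarrow> m p q = 0) \<and>
     (\<forall>p\<in>infinite_cone Y. \<forall>q\<in>infinite_cone Y. m p q \<le> cone_dist Y p q) \<and>
     (\<forall>p\<in>infinite_cone Y. \<forall>s\<in>S. m p (cone_action \<phi> s p) \<le> 1)"

definition warped_dist ::
  "'g set \<Rightarrow> 'y::metric_space set \<Rightarrow> ('g \<Rightarrow> 'y \<Rightarrow> 'y) \<Rightarrow> real \<times> 'y \<Rightarrow> real \<times> 'y \<Rightarrow> real" where
  "warped_dist S Y \<phi> = (GREATEST m. warping_metric S Y \<phi> m)"

definition warped_cone ::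
  "'g set \<Rightarrow> 'y::metric_space set \<Rightarrow> ('g \<Rightarrow> 'y \<Rightarrow> 'y) \<Rightarrow> (real \<times> 'y) metric" where
  "warped_cone S Y \<phi> = metric (infinite_cone Y, warped_dist S Y \<phi>)"

lemma cone_dist_commute: "cone_dist Y p q = cone_dist Y q p"
  by (simp add: cone_dist_def abs_minus_commute min.commute dist_commute)

lemma Metric_space_cone_dist:
  assumes "compact Y" "diameter Y > 0"
  shows "Metric_space (infinite_cone Y) (\<lambda>p q. if p \<in> infinite_cone Y \<and> q \<in> infinite_cone Y then cone_dist Y p q else 0)"
proof -
  let ?D = "diameter Y"
  have le: "dist x y \<le> ?D" if "x \<in> Y" "y \<in> Y" for x y
    using diameter_bounded_bound[OF compact_imp_bounded[OF assms(1)]] that by blast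
  have nonneg: "cone_dist Y p q \<ge> 0" if "p \<in> infinite_cone Y" "q \<in> infinite_cone Y" for p q
    using that assms by (auto simp: cone_dist_def infinite_cone_def)
  have zero: "cone_dist Y p q = 0 \<longleftrightarrow> p = q" if "p \<in> infinite_cone Y" "q \<in> infinite_cone Y" for p q
  proof
    assume z: "cone_dist Y p q = 0"
    have "0 \<le> \<bar>fst p - fst q\<bar> * ?D" "0 \<le> min (fst p) (fst q) * dist (snd p) (snd q)"
      using that assms by (auto simp: infinite_cone_def)
    with z have "\<bar>fst p - fst q\<bar> * ?D = 0" "min (fst p) (fst q) * dist (snd p) (snd q) = 0"
      unfolding cone_dist_def by linarith+
    then show "p = q"
      using that assms by (auto simp: infinite_cone_def prod_eq_iff min_def split: if_splits)
  qed (simp add: cone_dist_def)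
  have tri_aux: "\<bar>a - c\<bar> * ?D + min a c * dist x z
      \<le> (\<bar>a - b\<bar> * ?D + min a b * dist x y) + (\<bar>b - c\<bar> * ?D + min b c * dist y z)"
    if "0 < a" "0 < b" "0 < c" "x \<in> Y" "y \<in> Y" "z \<in> Y" "a \<le> c" for a b c x y z
  proof (cases "a \<le> b")
    case True
    have "a * dist x z \<le> a * (dist x y + dist y z)"
      using that by (intro mult_left_mono dist_triangle) auto
    also have "\<dots> \<le> min a b * dist x y + min b c * dist y z"
      using True that mult_right_mono[of a "min b c" "dist y z"] by (simp add: algebra_simps)
    moreover have "\<bar>a - c\<bar> * ?D \<le> (\<bar>a - b\<bar> + \<bar>b - c\<bar>) * ?D"
      using assms by (intro mult_right_mono) auto
    ultimately show ?thesis using that by (simp add: algebra_simps)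
  next
    case False
    have "b * dist x z \<le> b * (dist x y + dist y z)"
      using that by (intro mult_left_mono dist_triangle) auto
    moreover have "(a - b) * dist x z \<le> (a - b) * ?D"
      using that False le by (intro mult_left_mono) auto
    moreover have "0 \<le> (a - b) * ?D" using False assms by auto
    ultimately show ?thesis using that False by (simp add: min_def algebra_simps)
  qed
  have tri: "cone_dist Y p r \<le> cone_dist Y p q + cone_dist Y q r"
    if "p \<in> infinite_cone Y" "q \<in> infinite_cone Y" "r \<in> infinite_cone Y" for p q r
  proof (cases "fst p \<le> fst r")
    case True
    then show ?thesis
      using that tri_aux[of "fst p" "fst q" "fst r" "snd p" "snd q" "snd r"]
      by (auto simp: cone_dist_def infinite_cone_def)
  next
    case False
    then have "cone_dist Y r p \<le> cone_dist Y r q + cone_dist Y q p"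
      using that tri_aux[of "fst r" "fst q" "fst p" "snd r" "snd q" "snd p"]
      by (auto simp: cone_dist_def infinite_cone_def)
    then show ?thesis by (simp add: cone_dist_commute)
  qed
  show ?thesis
    by unfold_locales (auto simp: nonneg zero tri cone_dist_commute)
qed

text \<open>The largest metric exists, so the operator \<open>GREATEST\<close> above is meaningful.\<close>

lemma warped_dist_greatest:
  assumes "compact Y" "diameter Y > 0"
  shows "warping_metric S Y \<phi> (warped_dist S Y \<phi>)"
    and "warping_metric S Y \<phi> m \<Longrightarrow> m \<le> warped_dist S Y \<phi>"
proof -
  let ?c = "\<lambda>p q. if p \<in> infinite_cone Y \<and> q \<in> infinite_cone Y then cone_dist Y p q else 0"
  let ?W = "{m. warping_metric S Y \<phi> m}"
  let ?m0 = "\<lambda>p q. min 1 (?c p q)"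
  let ?M = "\<lambda>p q. SUP m\<in>?W. m p q"
  interpret C: Metric_space "infinite_cone Y" ?c by (rule Metric_space_cone_dist[OF assms])
  have "Metric_space (infinite_cone Y) ?m0"
  proof
    show "?m0 x z \<le> ?m0 x y + ?m0 y z" if "x \<in> infinite_cone Y" "y \<in> infinite_cone Y" "z \<in> infinite_cone Y" for x y z
      using C.triangle[OF that] C.nonneg[of x y] C.nonneg[of y z] unfolding min_def
      by (smt (verit))
    show "0 \<le> ?m0 x y" for x y using C.nonneg[of x y] by (auto simp: min_def)
    show "?m0 x y = ?m0 y x" for x y using C.commute[of x y] by presburger
    show "(?m0 x y = 0) = (x = y)" if "x \<in> infinite_cone Y" "y \<in> infinite_cone Y" for x y
      using C.zero[OF that] by (auto simp: min_def split: if_splits)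
  qed
  then have m0: "?m0 \<in> ?W"
    unfolding warping_metric_def by (auto simp: min_def)
  have le_c: "m p q \<le> ?c p q" if "m \<in> ?W" for m p q
  proof (cases "p \<in> infinite_cone Y \<and> q \<in> infinite_cone Y")
    case True
    then show ?thesis using that unfolding warping_metric_def mem_Collect_eq by presburger
  next
    case False
    then have "m p q = 0" using that unfolding warping_metric_def mem_Collect_eq by blast
    then show ?thesis using False by (simp only: if_False order_refl)
  qed
  have ms: "Metric_space (infinite_cone Y) m" if "m \<in> ?W" for m
    using that unfolding warping_metric_def mem_Collect_eq by blast
  have bdd: "bdd_above ((\<lambda>m. m p q) ` ?W)" for p q
    by (rule bdd_aboveI2[of _ _ "?c p q"]) (rule le_c)
  have upper: "m p q \<le> ?M p q" if "m \<in> ?W" for m p q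
    by (rule cSUP_upper[OF that bdd])
  have least: "?M p q \<le> u" if "\<And>m. m \<in> ?W \<Longrightarrow> m p q \<le> u" for p q u
    using m0 that by (intro cSUP_least) blast+
  have M0: "0 \<le> ?M x y" for x y
    by (rule order_trans[OF Metric_space.nonneg[OF ms[OF m0]] upper[OF m0]])
  have M_commute: "?M x y \<le> ?M y x" for x y
  proof (rule least)
    fix m assume m: "m \<in> ?W"
    show "m x y \<le> ?M y x"
      unfolding Metric_space.commute[OF ms[OF m], of x y] by (rule upper[OF m])
  qed
  have M: "Metric_space (infinite_cone Y) ?M"
  proof
    show "0 \<le> ?M x y" for x y by (rule M0)
    show "?M x y = ?M y x" for x y by (rule antisym[OF M_commute M_commute])
    show "(?M x y = 0) = (x = y)" if "x \<in> infinite_cone Y" "y \<in> infinite_cone Y" for x y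
    proof
      assume "?M x y = 0"
      then have "?m0 x y \<le> 0" using upper[OF m0, of x y] by linarith
      then have "?c x y \<le> 0" by (auto simp: min_def split: if_splits)
      then show "x = y" using C.zero[OF that] C.nonneg[of x y] by force
    next
      assume "x = y"
      have "?M x y \<le> ?c x y" by (rule least) (rule le_c)
      moreover have "?c x y = 0" using C.zero[OF that] \<open>x = y\<close> by blast
      ultimately show "?M x y = 0" using M0[of x y] by linarith
    qed
    show "?M x z \<le> ?M x y + ?M y z"
      if "x \<in> infinite_cone Y" "y \<in> infinite_cone Y" "z \<in> infinite_cone Y" for x y z
    proof (rule least)
      fix m assume m: "m \<in> ?W"
      show "m x z \<le> ?M x y + ?M y z"
        using Metric_space.triangle[OF ms[OF m] that] add_mono[OF upper[OF m] upper[OF m]]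
        by (rule order_trans)
    qed
  qed
  have W: "warping_metric S Y \<phi> ?M"
  proof (rule iffD2[OF warping_metric_def], intro conjI allI ballI impI)
    show "?M p q = 0" if "p \<notin> infinite_cone Y \<or> q \<notin> infinite_cone Y" for p q
    proof -
      have "?M p q \<le> 0"
      proof (rule least)
        show "m p q \<le> 0" if "m \<in> ?W" for m
          using le_c[OF that, of p q] \<open>p \<notin> infinite_cone Y \<or> q \<notin> infinite_cone Y\<close> by argo
      qed
      then show ?thesis using M0[of p q] by linarith
    qed
    show "?M p q \<le> cone_dist Y p q" if "p \<in> infinite_cone Y" "q \<in> infinite_cone Y" for p q
      by (rule least) (use that in \<open>unfold warping_metric_def mem_Collect_eq, blast\<close>)
    show "?M p (cone_action \<phi> s p) \<le> 1" if "p \<in> infinite_cone Y" "s \<in> S" for p s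
      by (rule least) (use that in \<open>unfold warping_metric_def mem_Collect_eq, blast\<close>)
  qed (rule M)
  have gr: "m \<le> ?M" if "warping_metric S Y \<phi> m" for m
    by (intro le_funI upper CollectI that)
  have eq: "warped_dist S Y \<phi> = ?M"
    unfolding warped_dist_def by (rule Greatest_equality[of "warping_metric S Y \<phi>", OF W gr])
  show "warping_metric S Y \<phi> (warped_dist S Y \<phi>)" using W eq by simp
  show "m \<le> warped_dist S Y \<phi>" if "warping_metric S Y \<phi> m" using gr[OF that] eq by simp
qed

lemma warped_cone_simps:
  assumes "compact Y" "diameter Y > 0"
  shows "mspace (warped_cone S Y \<phi>) = infinite_cone Y"
    and "mdist (warped_cone S Y \<phi>) = warped_dist S Y \<phi>"
proof -
  have "Metric_space (infinite_cone Y) (warped_dist S Y \<phi>)"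
    using warped_dist_greatest(1)[OF assms, of S \<phi>] unfolding warping_metric_def by blast
  then show "mspace (warped_cone S Y \<phi>) = infinite_cone Y"
    and "mdist (warped_cone S Y \<phi>) = warped_dist S Y \<phi>"
    unfolding warped_cone_def
    by (rule Metric_space.mspace_metric, rule Metric_space.mdist_metric)
qed

section \<open>Hilbert spaces on a carrier set\<close>

text \<open>The class \<open>{real_inner,banach}\<close> describes a Hilbert space given by a type, which suffices
  for universally quantified Hilbert spaces. The following structure is used where the existence
  of a Hilbert space is asserted, since there is no existential quantification over types.\<close>

definition real_ring :: "real ring" where
  "real_ring = \<lparr>carrier = UNIV, mult = (*), one = 1, zero = 0, add = (+)\<rparr>"

record 'v inner_module = "(real, 'v) module" +
  ip :: "'v \<Rightarrow> 'v \<Rightarrow> real"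

definition ip_dist :: "'v inner_module \<Rightarrow> 'v \<Rightarrow> 'v \<Rightarrow> real" where
  "ip_dist H x y =
     (if x \<in> carrier H \<and> y \<in> carrier H then sqrt (ip H (x \<ominus>\<^bsub>H\<^esub> y) (x \<ominus>\<^bsub>H\<^esub> y)) else 0)"

locale inner_product_space = Module.module real_ring H for H :: "'v inner_module" +
  assumes ip_commute:
      "\<lbrakk>x \<in> carrier H; y \<in> carrier H\<rbrakk> \<Longrightarrow> ip H x y = ip H y x"
    and ip_add_left:
      "\<lbrakk>x \<in> carrier H; y \<in> carrier H; z \<in> carrier H\<rbrakk> \<Longrightarrow>
        ip H (x \<oplus>\<^bsub>H\<^esub> y) z = ip H x z + ip H y z"
    and ip_smult_left:
      "\<lbrakk>x \<in> carrier H; y \<in> carrier H\<rbrakk> \<Longrightarrow> ip H (a \<odot>\<^bsub>H\<^esub> x) y = a * ip H x y"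
    and ip_nonneg: "x \<in> carrier H \<Longrightarrow> 0 \<le> ip H x x"
    and ip_eq_0: "x \<in> carrier H \<Longrightarrow> ip H x x = 0 \<Longrightarrow> x = \<zero>\<^bsub>H\<^esub>"

locale hilbert_space = inner_product_space +
  assumes complete: "Metric_space.mcomplete (carrier H) (ip_dist H)"

definition hilbert_metric :: "'v inner_module \<Rightarrow> 'v metric" where
  "hilbert_metric H = metric (carrier H, ip_dist H)"

context inner_product_space
begin

lemma ip_zero_left: "y \<in> carrier H \<Longrightarrow> ip H \<zero>\<^bsub>H\<^esub> y = 0"
  using ip_add_left[of "\<zero>\<^bsub>H\<^esub>" "\<zero>\<^bsub>H\<^esub>" y] by simp

lemma ip_minus_left:
  assumes "x \<in> carrier H" "y \<in> carrier H"
  shows "ip H (\<ominus>\<^bsub>H\<^esub> x) y = - ip H x y"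
  using ip_add_left[of x "\<ominus>\<^bsub>H\<^esub> x" y] assms by (simp add: ip_zero_left M.r_neg)

lemma ip_add_smult:
  assumes "x \<in> carrier H" "y \<in> carrier H"
  shows "ip H (x \<oplus>\<^bsub>H\<^esub> a \<odot>\<^bsub>H\<^esub> y) (x \<oplus>\<^bsub>H\<^esub> a \<odot>\<^bsub>H\<^esub> y)
    = ip H x x + 2 * a * ip H x y + a\<^sup>2 * ip H y y"
proof -
  have ay: "a \<odot>\<^bsub>H\<^esub> y \<in> carrier H"
    using assms by (intro smult_closed) (auto simp: real_ring_def)
  let ?s = "x \<oplus>\<^bsub>H\<^esub> a \<odot>\<^bsub>H\<^esub> y"
  have s: "?s \<in> carrier H" using ay assms by simp
  have l: "ip H z ?s = ip H z x + a * ip H z y" if "z \<in> carrier H" for z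
    using that ay s assms ip_commute[OF that s] ip_add_left[of x "a \<odot>\<^bsub>H\<^esub> y" z]
      ip_smult_left[of y z a] ip_commute[of x z] ip_commute[of y z] by simp
  have "ip H ?s ?s = ip H x ?s + a * ip H y ?s"
    using ip_add_left[OF assms(1) ay s] ip_smult_left[OF assms(2) s] by simp
  then show ?thesis
    using l assms ip_commute[of y x] by (simp add: algebra_simps power2_eq_square)
qed

lemma Cauchy_Schwarz:
  assumes "x \<in> carrier H" "y \<in> carrier H"
  shows "ip H x y \<le> sqrt (ip H x x) * sqrt (ip H y y)"
proof (cases "ip H y y = 0")
  case True
  then have "y = \<zero>\<^bsub>H\<^esub>" using ip_eq_0 assms by blast
  then have "ip H x y = 0" using ip_zero_left ip_commute assms by metis
  then show ?thesis using True by simp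
next
  case False
  let ?a = "- ip H x y / ip H y y"
  have "?a \<odot>\<^bsub>H\<^esub> y \<in> carrier H"
    using assms by (intro smult_closed) (auto simp: real_ring_def)
  then have "0 \<le> ip H x x + 2 * ?a * ip H x y + ?a\<^sup>2 * ip H y y"
    using ip_nonneg[of "x \<oplus>\<^bsub>H\<^esub> ?a \<odot>\<^bsub>H\<^esub> y"] ip_add_smult[OF assms, of ?a] assms by simp
  also have "\<dots> = ip H x x - (ip H x y)\<^sup>2 / ip H y y"
    using False by (simp add: field_simps power2_eq_square)
  finally have "(ip H x y)\<^sup>2 \<le> ip H x x * ip H y y"
    using False ip_nonneg[OF assms(2)] by (simp add: field_simps)
  then have "\<bar>ip H x y\<bar> \<le> sqrt (ip H x x * ip H y y)"
    using real_le_rsqrt by force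
  then show ?thesis by (simp add: real_sqrt_mult)
qed

lemma Metric_space_ip_dist: "Metric_space (carrier H) (ip_dist H)"
proof
  have neg: "ip H (\<ominus>\<^bsub>H\<^esub> u) (\<ominus>\<^bsub>H\<^esub> u) = ip H u u" if "u \<in> carrier H" for u
    using that ip_minus_left ip_commute by (metis M.a_inv_closed minus_minus)
  show "0 \<le> ip_dist H x y" for x y
    by (auto simp: ip_dist_def intro!: ip_nonneg)
  show "ip_dist H x y = ip_dist H y x" for x y
    using neg[of "x \<ominus>\<^bsub>H\<^esub> y"]
    by (auto simp: ip_dist_def a_minus_def M.minus_add M.a_comm)
  show "(ip_dist H x y = 0) = (x = y)" if "x \<in> carrier H" "y \<in> carrier H" for x y
  proof -
    have "(ip_dist H x y = 0) = (x \<ominus>\<^bsub>H\<^esub> y = \<zero>\<^bsub>H\<^esub>)"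
      using that ip_eq_0[of "x \<ominus>\<^bsub>H\<^esub> y"] ip_zero_left[of "\<zero>\<^bsub>H\<^esub>"] by (auto simp: ip_dist_def)
    also have "\<dots> = (x = y)"
    proof
      assume z: "x \<ominus>\<^bsub>H\<^esub> y = \<zero>\<^bsub>H\<^esub>"
      have "x = (x \<ominus>\<^bsub>H\<^esub> y) \<oplus>\<^bsub>H\<^esub> y"
        using that by (simp add: a_minus_def M.a_assoc M.l_neg)
      then show "x = y" using z that by simp
    qed (use that in \<open>simp add: a_minus_def M.r_neg\<close>)
    finally show ?thesis .
  qed
  show "ip_dist H x z \<le> ip_dist H x y + ip_dist H y z"
    if c: "x \<in> carrier H" "y \<in> carrier H" "z \<in> carrier H" for x y z
  proof -
    let ?u = "x \<ominus>\<^bsub>H\<^esub> y" and ?v = "y \<ominus>\<^bsub>H\<^esub> z"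
    let ?nu = "sqrt (ip H ?u ?u)" and ?nv = "sqrt (ip H ?v ?v)"
    have uv: "?u \<in> carrier H" "?v \<in> carrier H" using c by auto
    have "?u \<oplus>\<^bsub>H\<^esub> ?v = x \<oplus>\<^bsub>H\<^esub> ((\<ominus>\<^bsub>H\<^esub> y \<oplus>\<^bsub>H\<^esub> y) \<oplus>\<^bsub>H\<^esub> \<ominus>\<^bsub>H\<^esub> z)"
      using c by (simp add: a_minus_def M.a_assoc)
    then have eq: "x \<ominus>\<^bsub>H\<^esub> z = ?u \<oplus>\<^bsub>H\<^esub> (1::real) \<odot>\<^bsub>H\<^esub> ?v"
      using c uv smult_one[of ?v] by (simp add: M.l_neg a_minus_def real_ring_def)
    have "ip H (x \<ominus>\<^bsub>H\<^esub> z) (x \<ominus>\<^bsub>H\<^esub> z) = ip H ?u ?u + 2 * ip H ?u ?v + ip H ?v ?v"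
      unfolding eq using ip_add_smult[OF uv, of 1] by simp
    also have "\<dots> \<le> (?nu + ?nv)\<^sup>2"
      using Cauchy_Schwarz[OF uv] ip_nonneg[OF uv(1)] ip_nonneg[OF uv(2)]
      by (simp add: power2_sum)
    finally have "sqrt (ip H (x \<ominus>\<^bsub>H\<^esub> z) (x \<ominus>\<^bsub>H\<^esub> z)) \<le> ?nu + ?nv"
      using ip_nonneg[OF uv(1)] ip_nonneg[OF uv(2)] by (intro real_le_lsqrt) auto
    then show ?thesis using c by (simp add: ip_dist_def)
  qed
qed

lemma hilbert_metric_simps:
  "mspace (hilbert_metric H) = carrier H" "mdist (hilbert_metric H) = ip_dist H"
  using Metric_space_ip_dist
  by (auto simp: hilbert_metric_def Metric_space.mspace_metric Metric_space.mdist_metric)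

end

text \<open>Every Hilbert space given by a type is a Hilbert space in this sense.\<close>

definition hilbert_of_type :: "'v::{real_inner,banach} inner_module" where
  "hilbert_of_type = \<lparr>carrier = UNIV, mult = (\<lambda>_ _. 0), one = 0, zero = 0, add = (+),
     smult = (*\<^sub>R), ip = inner\<rparr>"

lemma cring_real_ring: "cring real_ring"
proof -
  have "\<exists>y::real. y + x = 0 \<and> x + y = 0" for x by (rule exI[of _ "- x"]) simp
  then show ?thesis
    by (intro cringI abelian_groupI comm_monoidI)
      (auto simp: real_ring_def algebra_simps)
qed

lemma hilbert_space_of_type:
  "hilbert_space (hilbert_of_type :: 'v::{real_inner,banach} inner_module)"
  "hilbert_metric (hilbert_of_type :: 'v inner_module) = euclidean_metric"
proof -
  let ?H = "hilbert_of_type :: 'v inner_module"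
  have ag: "abelian_group ?H"
  proof (rule abelian_groupI)
    show "\<exists>y\<in>carrier ?H. y \<oplus>\<^bsub>?H\<^esub> x = \<zero>\<^bsub>?H\<^esub>" for x
      by (rule bexI[of _ "- x"]) (auto simp: hilbert_of_type_def)
  qed (auto simp: hilbert_of_type_def algebra_simps)
  then interpret A: abelian_group ?H .
  have "\<ominus>\<^bsub>?H\<^esub> y = - y" for y
    by (rule A.minus_equality) (auto simp: hilbert_of_type_def)
  then have minus: "x \<ominus>\<^bsub>?H\<^esub> y = x - y" for x y
    unfolding a_minus_def by (simp add: hilbert_of_type_def)
  have "Module.module real_ring ?H"
    by (rule moduleI[OF cring_real_ring ag])
      (auto simp: hilbert_of_type_def real_ring_def algebra_simps)
  then have ips: "inner_product_space ?H"
    by (auto simp: inner_product_space_def inner_product_space_axioms_def hilbert_of_type_def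
        inner_add_left inner_add_right intro: inner_commute)
  have dist: "ip_dist ?H = dist"
    by (intro ext) (simp add: ip_dist_def minus dist_norm norm_eq_sqrt_inner,
        simp add: hilbert_of_type_def)
  have carrier: "carrier ?H = UNIV" by (simp add: hilbert_of_type_def)
  show "hilbert_space ?H"
    unfolding hilbert_space_def hilbert_space_axioms_def carrier dist
    using ips complete_UNIV mcomplete_iff_complete by blast
  show "hilbert_metric ?H = euclidean_metric"
    by (simp add: hilbert_metric_def euclidean_metric_def carrier dist)
qed

section \<open>Fibred coarse embeddings\<close>

definition isometry_onto :: "'a metric \<Rightarrow> 'b metric \<Rightarrow> ('a \<Rightarrow> 'b) \<Rightarrow> bool" where
  "isometry_onto A B t \<longleftrightarrow>
     t ` mspace A = mspace B \<and>
     (\<forall>u\<in>mspace A. \<forall>v\<in>mspace A. mdist B (t u) (t v) = mdist A u v)"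

definition control_function :: "(real \<Rightarrow> real) \<Rightarrow> bool" where
  "control_function \<rho> \<longleftrightarrow>
     (\<forall>r\<ge>0. \<rho> r \<ge> 0) \<and> mono_on {0..} \<rho> \<and> \<not> bdd_above (\<rho> ` {0..})"

text \<open>The disjoint union of the fibres \<open>F y\<close> with \<open>y \<in> B\<close>.\<close>

definition total_space :: "'x set \<Rightarrow> ('x \<Rightarrow> 'e metric) \<Rightarrow> ('x \<times> 'e) set" where
  "total_space B F = (SIGMA y:B. mspace (F y))"

definition trivialisation ::
  "'x set \<Rightarrow> ('x \<Rightarrow> 'e metric) \<Rightarrow> 'e metric \<Rightarrow> ('x \<times> 'e \<Rightarrow> 'x \<times> 'e) \<Rightarrow> bool" where
  "trivialisation B F E \<tau> \<longleftrightarrow>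
     (\<forall>y\<in>B. \<tau> ` ({y} \<times> mspace (F y)) = {y} \<times> mspace E \<and>
        isometry_onto (F y) E (\<lambda>v. snd (\<tau> (y, v))))"

text \<open>Only the metric of the target \<open>E\<close> enters the notion: for a normed space,
  \<open>mdist E u v\<close> is the norm of \<open>u - v\<close>. The fibres are metric spaces on subsets of the same type
  as \<open>E\<close>, which is no restriction because they are isometric to \<open>E\<close>.\<close>

definition fibred_coarse_embedding :: "'x metric \<Rightarrow> 'e metric \<Rightarrow> bool" where
  "fibred_coarse_embedding X E \<longleftrightarrow>
     (\<exists>(F :: 'x \<Rightarrow> 'e metric) (f :: nat \<Rightarrow> 'x \<Rightarrow> 'e) \<rho>\<^sub>m \<rho>\<^sub>p.
        (\<forall>x\<in>mspace X. \<exists>j. isometry_onto (F x) E j) \<and>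
        (\<forall>n. \<forall>x\<in>mspace X. f n x \<in> mspace (F x)) \<and>
        control_function \<rho>\<^sub>m \<and> control_function \<rho>\<^sub>p \<and>
        (\<forall>n. \<exists>K \<tau>.
           K \<subseteq> mspace X \<and> Metric_space.mbounded (mspace X) (mdist X) K \<and>
           (\<forall>x \<in> mspace X - K.
              trivialisation (mball_of X x (real n)) F E (\<tau> x) \<and>
              (\<forall>y \<in> mball_of X x (real n). \<forall>y' \<in> mball_of X x (real n).
                 let \<delta> = mdist E (snd (\<tau> x (y, f n y))) (snd (\<tau> x (y', f n y')))
                 in \<rho>\<^sub>m (mdist X y y') \<le> \<delta> \<and> \<delta> \<le> \<rho>\<^sub>p (mdist X y y'))) \<and>
           (\<forall>x \<in> mspace X - K. \<forall>x' \<in> mspace X - K.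
              let I = mball_of X x (real n) \<inter> mball_of X x' (real n)
              in I \<noteq> {} \<longrightarrow>
                 (\<exists>t. isometry_onto E E t \<and>
                    (\<forall>p \<in> I \<times> mspace E.
                       \<tau> x (inv_into (total_space (mball_of X x' (real n)) F) (\<tau> x') p)
                         = map_prod id t p)))))"

end

theory Submission
  imports Defs
begin

text \<open>Linearisability replaces the cone metric, up to bi-Lipschitz equivalence, by the metric of a
  Hilbert space pulled back along \<open>(r, y) \<mapsto> (r \<iota>(y), r)\<close>, and this metric is invariant under the
  group. For an invariant metric the warped distance from \<open>p\<close> to \<open>q\<close> is, up to constants, the
  infimum over \<open>g\<close> of the word length of \<open>g\<close> plus the distance from \<open>g p\<close> to \<open>q\<close>: chains of jumps
  and moves reduce to a single jump (\<open>warped_dist_less\<close>, \<open>wd_upper\<close>).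

  Since the action is free and \<open>Y\<close> is compact, the translates of a point by elements of a fixed
  word ball are far apart at large radius. Outside a bounded set the element \<open>g\<close> is therefore
  determined by \<open>p\<close> and \<open>q\<close> (\<open>near_translate_unique\<close>).

  Let \<open>\<pi>\<close> be the linear representation and \<open>\<alpha>\<close> the proper affine action. On a ball with centre \<open>x\<close>
  far out, let \<open>\<gamma>(p)\<close> be the element that carries \<open>x\<close> near \<open>p = (r, y)\<close>. The trivialised section is
  \<open>p \<mapsto> (r \<pi>(\<gamma>(p))\<^sup>-\<^sup>1 \<iota>(y), \<alpha>(\<gamma>(p))\<^sup>-\<^sup>1 0, r)\<close>. The distance between the images of \<open>p\<close> and \<open>q\<close>
  depends only on \<open>g = \<gamma>(q) \<gamma>(p)\<^sup>-\<^sup>1\<close>: the first and third coordinates give the distance from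
  \<open>g p\<close> to \<open>q\<close>, the second one the norm of \<open>\<alpha>(g) 0\<close>. The latter is at most linear in the word length
  of \<open>g\<close>, and it controls that word length because \<open>\<alpha>\<close> is proper. With the description of the warped
  metric this yields both control functions. Two trivialisations over a common point \<open>p\<close> differ by
  the action of the element that carries one centre near the other, which is unique and so
  independent of \<open>p\<close> (\<open>fibred_coarse_embedding_twisted\<close>).\<close>

section \<open>Word balls\<close>

text \<open>The ball of radius \<open>k\<close> about the identity in the word metric. Working with the balls
  instead of the word length avoids a minimum over words.\<close>

primrec word_ball :: "('g, 'm) monoid_scheme \<Rightarrow> 'g set \<Rightarrow> nat \<Rightarrow> 'g set" where
  "word_ball G S 0 = {\<one>\<^bsub>G\<^esub>}"
| "word_ball G S (Suc k) =
     word_ball G S k \<union> (\<lambda>(g, s). g \<otimes>\<^bsub>G\<^esub> s) ` (word_ball G S k \<times> (S \<union> m_inv G ` S))"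

lemma finite_word_ball: "finite S \<Longrightarrow> finite (word_ball G S k)"
  by (induction k) auto

lemma word_ball_mono: "j \<le> k \<Longrightarrow> word_ball G S j \<subseteq> word_ball G S k"
  by (induction k) (auto simp: le_Suc_eq)

lemma one_in_word_ball: "\<one>\<^bsub>G\<^esub> \<in> word_ball G S k"
  by (induction k) auto

context group
begin

lemma word_ball_subset: "S \<subseteq> carrier G \<Longrightarrow> word_ball G S k \<subseteq> carrier G"
  by (induction k) auto

lemma word_ball_mult:
  assumes S: "S \<subseteq> carrier G"
  shows "g \<in> word_ball G S j \<Longrightarrow> h \<in> word_ball G S k \<Longrightarrow> g \<otimes> h \<in> word_ball G S (j + k)"
proof (induction k arbitrary: h)
  case 0
  then show ?case using word_ball_subset[OF S, of j] by auto
next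
  case (Suc k)
  from Suc.prems(2) consider "h \<in> word_ball G S k"
    | h' s where "h' \<in> word_ball G S k" "s \<in> S \<union> m_inv G ` S" "h = h' \<otimes> s" by auto
  then show ?case
  proof cases
    case 1
    then show ?thesis using Suc.IH Suc.prems(1) by auto
  next
    case 2
    have "g \<otimes> h' \<in> word_ball G S (j + k)" using Suc.IH Suc.prems(1) 2 by blast
    moreover have "g \<otimes> h = (g \<otimes> h') \<otimes> s"
      using 2 word_ball_subset[OF S, of k] word_ball_subset[OF S, of j] Suc.prems(1) S m_assoc
      by (metis (no_types, lifting) Un_iff image_iff inv_closed subsetD)
    ultimately show ?thesis using 2(2) by force
  qed
qed

lemma generator_in_word_ball:
  assumes S: "S \<subseteq> carrier G" and s: "s \<in> S \<union> m_inv G ` S"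
  shows "s \<in> word_ball G S 1"
proof -
  have "s \<in> carrier G" using assms by auto
  then have "s = \<one> \<otimes> s" by simp
  then show ?thesis using s by force
qed

lemma word_ball_inv:
  assumes S: "S \<subseteq> carrier G"
  shows "g \<in> word_ball G S k \<Longrightarrow> inv g \<in> word_ball G S k"
proof (induction k arbitrary: g)
  case 0
  then show ?case by simp
next
  case (Suc k)
  from Suc.prems consider "g \<in> word_ball G S k"
    | h s where "h \<in> word_ball G S k" "s \<in> S \<union> m_inv G ` S" "g = h \<otimes> s" by auto
  then show ?case
  proof cases
    case 1
    then show ?thesis using Suc.IH by auto
  next
    case 2
    have hs: "h \<in> carrier G" "s \<in> carrier G" using 2 word_ball_subset[OF S, of k] S by auto
    have "inv s \<in> S \<union> m_inv G ` S" using 2(2) S by auto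
    then have "inv s \<in> word_ball G S 1" by (rule generator_in_word_ball[OF S])
    then have "inv s \<otimes> inv h \<in> word_ball G S (1 + k)"
      using Suc.IH 2(1) by (intro word_ball_mult[OF S]) auto
    then show ?thesis using 2(3) hs by (simp only: inv_mult_group plus_1_eq_Suc)
  qed
qed

lemma generate_word_ball:
  assumes S: "S \<subseteq> carrier G" and g: "g \<in> generate G S"
  shows "\<exists>k. g \<in> word_ball G S k"
  using g
proof (induction rule: generate.induct)
  case one
  show ?case using one_in_word_ball by blast
next
  case (incl h)
  then show ?case using generator_in_word_ball[OF S] by blast
next
  case (inv h)
  then show ?case using generator_in_word_ball[OF S] by blast
next
  case (eng g h)
  then show ?case using word_ball_mult[OF S] by blast
qed

end

section \<open>The warped metric of a linearised action\<close>

text \<open>What linearisability says about the cone: a map \<open>J\<close> into a metric space that is bi-Lipschitz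
  for the cone metric and whose pull-back distance is invariant under the group. The cone metric
  itself need not be invariant, and the invariance is what makes the warped metric computable.\<close>

locale linearised_cone = group G for G (structure) +
  fixes S :: "'a set"
    and Y :: "'y::metric_space set"
    and \<phi> :: "'a \<Rightarrow> 'y \<Rightarrow> 'y"
    and J :: "real \<times> 'y \<Rightarrow> 'e::metric_space"
    and \<kappa> A :: real
  assumes fin_S: "finite S" and S_carrier: "S \<subseteq> carrier G"
    and generating: "generate G S = carrier G"
    and compact_Y: "compact Y" and diam_pos: "diameter Y > 0"
    and action: "continuous_action G Y \<phi>"
    and free: "free_action G Y \<phi>"
    and \<kappa>_pos: "\<kappa> > 0" and A_pos: "A > 0"
    and J_upper: "\<lbrakk>p \<in> infinite_cone Y; q \<in> infinite_cone Y\<rbrakk> \<Longrightarrow>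
        \<kappa> * dist (J p) (J q) \<le> cone_dist Y p q"
    and J_lower: "\<lbrakk>p \<in> infinite_cone Y; q \<in> infinite_cone Y\<rbrakk> \<Longrightarrow>
        cone_dist Y p q \<le> A * dist (J p) (J q)"
    and J_invariant: "\<lbrakk>g \<in> carrier G; p \<in> infinite_cone Y; q \<in> infinite_cone Y\<rbrakk> \<Longrightarrow>
        dist (J (cone_action \<phi> g p)) (J (cone_action \<phi> g q)) = dist (J p) (J q)"
begin

abbreviation "OY \<equiv> infinite_cone Y"
abbreviation "act \<equiv> cone_action \<phi>"
abbreviation "ball_of k \<equiv> word_ball G S k"
abbreviation "jd p q \<equiv> dist (J p) (J q)"
abbreviation "wd \<equiv> warped_dist S Y \<phi>"

lemma ball_carrier: "g \<in> ball_of k \<Longrightarrow> g \<in> carrier G"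
  using word_ball_subset[OF S_carrier] by blast

lemma group_action_Y: "group_action G Y \<phi>"
  using action by (simp add: continuous_action_def)

lemma act_cone: "\<lbrakk>g \<in> carrier G; p \<in> OY\<rbrakk> \<Longrightarrow> act g p \<in> OY"
  using group_action.element_image[OF group_action_Y]
  by (auto simp: cone_action_def infinite_cone_def)

lemma act_mult: "\<lbrakk>g \<in> carrier G; h \<in> carrier G; p \<in> OY\<rbrakk> \<Longrightarrow> act (g \<otimes> h) p = act g (act h p)"
  using group_action.composition_rule[OF group_action_Y]
  by (auto simp: cone_action_def infinite_cone_def)

lemma act_one: "p \<in> OY \<Longrightarrow> act \<one> p = p"
  using group_action.id_eq_one[OF group_action_Y, symmetric]
  by (auto simp: cone_action_def infinite_cone_def)

lemma fst_act: "fst (act g p) = fst p"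
  by (simp add: cone_action_def)

text \<open>Invariance lets a group element cross from one argument of the distance to the other.\<close>

lemma jd_inv:
  assumes "g \<in> carrier G" "p \<in> OY" "q \<in> OY"
  shows "jd (act (inv g) p) q = jd p (act g q)"
proof -
  have "jd (act (inv g) p) q = jd (act g (act (inv g) p)) (act g q)"
    using assms by (intro J_invariant[symmetric]) (auto intro: act_cone)
  also have "act g (act (inv g) p) = p"
    using assms act_mult[of g "inv g" p] act_one by simp
  finally show ?thesis .
qed

lemma jd_pos:
  assumes "p \<in> OY" "q \<in> OY" "p \<noteq> q"
  shows "0 < jd p q"
proof -
  interpret C: Metric_space OY "\<lambda>p q. if p \<in> OY \<and> q \<in> OY then cone_dist Y p q else 0"
    by (rule Metric_space_cone_dist[OF compact_Y diam_pos])
  have "cone_dist Y p q \<noteq> 0" using C.zero[OF assms(1,2)] assms by auto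
  then have "J p \<noteq> J q" using J_lower[OF assms(1,2)] C.nonneg[of p q] assms by auto
  then show ?thesis by simp
qed

text \<open>One jump by a group element of word length at most \<open>k\<close>, at cost \<open>k\<close>, followed by one move
  inside the cone. The warped metric allows arbitrary chains of jumps and moves; for an invariant
  distance all jumps of a chain can be made first, so that this single step suffices.\<close>

definition costs :: "real \<times> 'y \<Rightarrow> real \<times> 'y \<Rightarrow> real set" where
  "costs p q = {real k + \<kappa> * jd (act g p) q |k g. g \<in> ball_of k}"

definition displacement_metric :: "real \<times> 'y \<Rightarrow> real \<times> 'y \<Rightarrow> real" where
  "displacement_metric p q = (if p \<in> OY \<and> q \<in> OY then Inf (costs p q) else 0)"

lemma costs_I: "g \<in> ball_of k \<Longrightarrow> real k + \<kappa> * jd (act g p) q \<in> costs p q"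
  unfolding costs_def by blast

lemma costs_nonempty: "costs p q \<noteq> {}"
  using costs_I[OF one_in_word_ball] by blast

lemma costs_nonneg: "t \<in> costs p q \<Longrightarrow> 0 \<le> t"
  using \<kappa>_pos unfolding costs_def by auto

lemma costs_bdd: "bdd_below (costs p q)"
  using costs_nonneg by (rule bdd_belowI)

lemma displacement_le:
  "\<lbrakk>p \<in> OY; q \<in> OY; g \<in> ball_of k\<rbrakk> \<Longrightarrow>
    displacement_metric p q \<le> real k + \<kappa> * jd (act g p) q"
  unfolding displacement_metric_def by (auto intro!: cInf_lower costs_I costs_bdd)

lemma displacement_less:
  assumes "p \<in> OY" "q \<in> OY" "displacement_metric p q < T"
  shows "\<exists>k. \<exists>g\<in>ball_of k. real k + \<kappa> * jd (act g p) q < T"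
  using assms cInf_less_iff[OF costs_nonempty costs_bdd, of p q T]
  unfolding displacement_metric_def costs_def by auto

lemma costs_commute_subset:
  assumes "p \<in> OY" "q \<in> OY"
  shows "costs p q \<subseteq> costs q p"
proof
  fix t assume "t \<in> costs p q"
  then obtain k g where g: "g \<in> ball_of k" and t: "t = real k + \<kappa> * jd (act g p) q"
    unfolding costs_def by blast
  have "t = real k + \<kappa> * jd (act (inv g) q) p"
    using jd_inv[OF ball_carrier[OF g] assms(2,1)] t by (simp add: dist_commute)
  then show "t \<in> costs q p" using costs_I[OF word_ball_inv[OF S_carrier g]] by simp
qed

text \<open>The triangle inequality is the combination of two jumps into one: the element moving \<open>p\<close>
  near \<open>q\<close> and the one moving \<open>q\<close> near \<open>r\<close> compose, and the error of the first survives the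
  second unchanged because the distance of \<open>J\<close> is invariant. Distinct points have positive
  distance since any jump by an element other than the identity costs at least \<open>1\<close>.\<close>

lemma Metric_space_displacement: "Metric_space OY displacement_metric"
proof
  show nonneg: "0 \<le> displacement_metric p q" for p q
    using cInf_greatest[OF costs_nonempty costs_nonneg, of p q]
    unfolding displacement_metric_def by simp
  show "displacement_metric p q = displacement_metric q p" for p q
    unfolding displacement_metric_def using costs_commute_subset by (metis subset_antisym)
  show "(displacement_metric p q = 0) = (p = q)" if pq: "p \<in> OY" "q \<in> OY" for p q
  proof
    assume "p = q"
    then have "displacement_metric p q \<le> 0"
      using displacement_le[OF pq one_in_word_ball, of 0] act_one pq by simp
    then show "displacement_metric p q = 0" using nonneg[of p q] by simp
  next
    assume z: "displacement_metric p q = 0"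
    show "p = q"
    proof (rule ccontr)
      assume "p \<noteq> q"
      then have pos: "0 < \<kappa> * jd p q" using jd_pos pq \<kappa>_pos by simp
      with z have "displacement_metric p q < min 1 (\<kappa> * jd p q)" by simp
      from displacement_less[OF pq this] obtain k g
        where g: "g \<in> ball_of k" and less: "real k + \<kappa> * jd (act g p) q < min 1 (\<kappa> * jd p q)"
        by blast
      have "0 \<le> \<kappa> * jd (act g p) q" using \<kappa>_pos by simp
      with less have "real k < 1" by linarith
      then have "g = \<one>" using g by simp
      then show False using less act_one[OF pq(1)] by simp
    qed
  qed
  show "displacement_metric p r \<le> displacement_metric p q + displacement_metric q r"
    if c: "p \<in> OY" "q \<in> OY" "r \<in> OY" for p q r
  proof -
    have step: "displacement_metric p r \<le> s + t" if st: "s \<in> costs p q" "t \<in> costs q r" for s t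
    proof -
      obtain k g where g: "g \<in> ball_of k" and s: "s = real k + \<kappa> * jd (act g p) q"
        using st(1) unfolding costs_def by blast
      obtain l h where h: "h \<in> ball_of l" and t: "t = real l + \<kappa> * jd (act h q) r"
        using st(2) unfolding costs_def by blast
      note gh = ball_carrier[OF g] ball_carrier[OF h]
      have "jd (act (h \<otimes> g) p) r \<le> jd (act h (act g p)) (act h q) + jd (act h q) r"
        using act_mult[OF gh(2,1) c(1)] dist_triangle by metis
      also have "jd (act h (act g p)) (act h q) = jd (act g p) q"
        using J_invariant gh act_cone c by simp
      finally have "\<kappa> * jd (act (h \<otimes> g) p) r \<le> \<kappa> * (jd (act g p) q + jd (act h q) r)"
        using \<kappa>_pos by simp
      then show ?thesis
        using displacement_le[OF c(1,3) word_ball_mult[OF S_carrier h g]] s t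
        by (simp add: algebra_simps)
    qed
    have "displacement_metric p r - s \<le> Inf (costs q r)" if "s \<in> costs p q" for s
      using step[OF that] by (intro cInf_greatest costs_nonempty) (simp add: algebra_simps)
    then have "displacement_metric p r - Inf (costs q r) \<le> Inf (costs p q)"
      by (intro cInf_greatest costs_nonempty) (simp add: algebra_simps)
    then show ?thesis using c by (simp add: displacement_metric_def)
  qed
qed

lemma warping_metric_displacement: "warping_metric S Y \<phi> displacement_metric"
proof -
  have "displacement_metric p q \<le> cone_dist Y p q" if "p \<in> OY" "q \<in> OY" for p q
    using displacement_le[OF that one_in_word_ball, of 0] J_upper[OF that] act_one that by simp
  moreover have "displacement_metric p (act s p) \<le> 1" if "p \<in> OY" "s \<in> S" for p s
  proof -
    have s: "s \<in> carrier G" using that S_carrier by blast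
    show ?thesis
      using displacement_le[OF that(1) act_cone[OF s that(1)]
          generator_in_word_ball[OF S_carrier UnI1[OF that(2)]]] by simp
  qed
  ultimately show ?thesis
    unfolding warping_metric_def using Metric_space_displacement
    by (auto simp: displacement_metric_def)
qed

text \<open>The geometric description of warped distances: points at warped distance below \<open>T\<close> are
  joined by one short group element up to a bounded error. It holds because the displacement
  metric is one of the metrics of which the warped metric is the largest.\<close>

lemma warped_dist_less:
  assumes "p \<in> OY" "q \<in> OY" "wd p q < T"
  shows "\<exists>k. \<exists>g\<in>ball_of k. real k + \<kappa> * jd (act g p) q < T"
proof -
  have "displacement_metric p q \<le> wd p q"
    using warped_dist_greatest(2)[OF compact_Y diam_pos warping_metric_displacement]
    by (rule le_funD[THEN le_funD])
  then show ?thesis using displacement_less assms by simp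
qed

lemma warping_metric_wd: "warping_metric S Y \<phi> wd"
  by (rule warped_dist_greatest(1)[OF compact_Y diam_pos])

lemma Metric_space_wd: "Metric_space OY wd"
  using warping_metric_wd by (simp add: warping_metric_def)

lemma wd_le_cone_dist: "\<lbrakk>p \<in> OY; q \<in> OY\<rbrakk> \<Longrightarrow> wd p q \<le> cone_dist Y p q"
  using warping_metric_wd by (simp add: warping_metric_def)

lemma wd_act_le: "\<lbrakk>g \<in> ball_of k; p \<in> OY\<rbrakk> \<Longrightarrow> wd p (act g p) \<le> real k"
proof (induction k arbitrary: g p)
  case 0
  then show ?case using act_one Metric_space.mdist_zero[OF Metric_space_wd] by simp
next
  case (Suc k)
  from Suc.prems(1) consider "g \<in> ball_of k"
    | h s where "h \<in> ball_of k" "s \<in> S \<union> m_inv G ` S" "g = h \<otimes> s" by auto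
  then show ?case
  proof cases
    case 1
    then show ?thesis using Suc.IH Suc.prems by fastforce
  next
    case 2
    note h = ball_carrier[OF 2(1)]
    have s: "s \<in> carrier G" using 2 S_carrier by auto
    have gen: "wd x (act s' x) \<le> 1" if "x \<in> OY" "s' \<in> S" for x s'
      using warping_metric_wd that by (simp add: warping_metric_def)
    have "wd p (act s p) \<le> 1"
    proof (cases "s \<in> S")
      case False
      then obtain s' where s': "s' \<in> S" "s = inv s'" using 2(2) by auto
      then have c: "s' \<in> carrier G" using S_carrier by auto
      have "act s' (act s p) = p"
        using act_mult[OF c s Suc.prems(2)] act_one Suc.prems(2) s'(2) c by simp
      then show ?thesis
        using gen[OF act_cone[OF s Suc.prems(2)] s'(1)]
          Metric_space.commute[OF Metric_space_wd] by metis
    qed (use gen Suc.prems in blast)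
    moreover have "wd (act s p) (act g p) \<le> real k"
      using Suc.IH[OF 2(1) act_cone[OF s Suc.prems(2)]] act_mult[OF h s Suc.prems(2)] 2(3) by simp
    moreover have "wd p (act g p) \<le> wd p (act s p) + wd (act s p) (act g p)"
      using Suc.prems h s 2(3)
      by (intro Metric_space.triangle[OF Metric_space_wd] act_cone) auto
    ultimately show ?thesis by simp
  qed
qed

text \<open>The converse of \<open>warped_dist_less\<close>, with \<open>A\<close> in place of \<open>\<kappa>\<close>: a jump by \<open>g\<close> is a chain of at most
  \<open>k\<close> jumps by generators or their inverses, each of warped length at most \<open>1\<close>.\<close>

lemma wd_upper:
  assumes "p \<in> OY" "q \<in> OY" "g \<in> ball_of k"
  shows "wd p q \<le> real k + A * jd (act g p) q"
proof -
  have gp: "act g p \<in> OY" using assms ball_carrier act_cone by blast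
  have "wd p q \<le> wd p (act g p) + wd (act g p) q"
    by (rule Metric_space.triangle[OF Metric_space_wd assms(1) gp assms(2)])
  also have "\<dots> \<le> real k + cone_dist Y (act g p) q"
    using wd_act_le[OF assms(3,1)] wd_le_cone_dist[OF gp assms(2)] by simp
  finally show ?thesis using J_lower[OF gp assms(2)] by simp
qed

section \<open>Separation of orbits at large radius\<close>

lemma Y_nonempty: "Y \<noteq> {}"
  using diam_pos by auto

lemma dist_le_diam: "\<lbrakk>x \<in> Y; y \<in> Y\<rbrakk> \<Longrightarrow> dist x y \<le> diameter Y"
  using diameter_bounded_bound[OF compact_imp_bounded[OF compact_Y]] by blast

lemma radius_diff_le:
  assumes "p \<in> OY" "q \<in> OY"
  shows "\<bar>fst p - fst q\<bar> \<le> A / diameter Y * jd p q"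
proof -
  have "0 \<le> min (fst p) (fst q) * dist (snd p) (snd q)"
    using assms by (auto simp: infinite_cone_def)
  then have "\<bar>fst p - fst q\<bar> * diameter Y \<le> A * jd p q"
    using J_lower[OF assms] by (simp add: cone_dist_def)
  then show ?thesis using diam_pos by (simp add: field_simps)
qed

lemma bounded_radius_mbounded: "Metric_space.mbounded OY wd {p \<in> OY. fst p \<le> R}"
proof -
  obtain y where y: "y \<in> Y" using Y_nonempty by blast
  have "{p \<in> OY. fst p \<le> R} \<subseteq> Metric_space.mcball OY wd (1, y) ((\<bar>R\<bar> + 2) * diameter Y)"
  proof
    fix p assume p: "p \<in> {p \<in> OY. fst p \<le> R}"
    have q: "(1, y) \<in> OY" using y by (simp add: infinite_cone_def)
    have fp: "0 < fst p" "snd p \<in> Y" using p by (auto simp: infinite_cone_def)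
    have "wd (1, y) p \<le> cone_dist Y (1, y) p" using p q wd_le_cone_dist by blast
    also have "\<dots> \<le> (\<bar>R\<bar> + 1) * diameter Y + 1 * diameter Y"
      unfolding cone_dist_def fst_conv snd_conv
      using p fp y dist_le_diam diam_pos by (intro add_mono mult_mono) auto
    finally show "p \<in> Metric_space.mcball OY wd (1, y) ((\<bar>R\<bar> + 2) * diameter Y)"
      using p q by (simp add: Metric_space.in_mcball[OF Metric_space_wd] algebra_simps)
  qed
  then show ?thesis unfolding Metric_space.mbounded_def[OF Metric_space_wd] by blast
qed

text \<open>For a free action the displacement between \<open>g y\<close> and \<open>h y\<close> never vanishes, so it attains a
  positive minimum on the compact space.\<close>

lemma orbit_points_separated_pair:
  assumes "g \<in> carrier G" "h \<in> carrier G" "g \<noteq> h"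
  shows "\<exists>\<epsilon>>0. \<forall>y\<in>Y. \<epsilon> \<le> dist (\<phi> g y) (\<phi> h y)"
proof -
  have "continuous_on Y (\<lambda>y. dist (\<phi> g y) (\<phi> h y))"
    using action assms by (auto simp: continuous_action_def intro!: continuous_intros)
  from continuous_attains_inf[OF compact_Y Y_nonempty this]
  obtain x where x: "x \<in> Y" "\<forall>y\<in>Y. dist (\<phi> g x) (\<phi> h x) \<le> dist (\<phi> g y) (\<phi> h y)" by blast
  have "\<phi> g x \<noteq> \<phi> h x"
  proof
    assume eq: "\<phi> g x = \<phi> h x"
    have "\<phi> (inv h \<otimes> g) x = \<phi> (inv h) (\<phi> h x)"
      using group_action.composition_rule[OF group_action_Y x(1)] assms eq by simp
    also have "\<dots> = x"
      using group_action.orbit_sym_aux[OF group_action_Y assms(2) x(1)] by simp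
    finally have "inv h \<otimes> g = \<one>"
      using free x(1) assms unfolding free_action_def by blast
    then have "g = h" using assms by (metis inv_closed inv_equality inv_inv)
    then show False using assms(3) by simp
  qed
  then show ?thesis using x by (intro exI[of _ "dist (\<phi> g x) (\<phi> h x)"]) auto
qed

lemma orbit_points_separated:
  "\<exists>\<epsilon>>0. \<forall>g\<in>ball_of N. \<forall>h\<in>ball_of N. g \<noteq> h \<longrightarrow> (\<forall>y\<in>Y. \<epsilon> \<le> dist (\<phi> g y) (\<phi> h y))"
proof -
  define P where "P = {(g, h). g \<in> ball_of N \<and> h \<in> ball_of N \<and> g \<noteq> h}"
  have fin: "finite P"
    by (rule finite_subset[of _ "ball_of N \<times> ball_of N"]) (auto simp: P_def finite_word_ball fin_S)
  have "\<exists>\<epsilon>>0. \<forall>y\<in>Y. \<epsilon> \<le> dist (\<phi> (fst x) y) (\<phi> (snd x) y)" if "x \<in> P" for x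
    using that by (intro orbit_points_separated_pair ball_carrier[of _ N]) (auto simp: P_def)
  then obtain \<epsilon> where \<epsilon>: "\<And>x. x \<in> P \<Longrightarrow> 0 < \<epsilon> x"
      "\<And>x y. x \<in> P \<Longrightarrow> y \<in> Y \<Longrightarrow> \<epsilon> x \<le> dist (\<phi> (fst x) y) (\<phi> (snd x) y)"
    by metis
  have "0 < Min (insert 1 (\<epsilon> ` P))" using fin \<epsilon>(1) by auto
  moreover have "Min (insert 1 (\<epsilon> ` P)) \<le> dist (\<phi> g y) (\<phi> h y)"
    if "g \<in> ball_of N" "h \<in> ball_of N" "g \<noteq> h" "y \<in> Y" for g h y
  proof -
    have x: "(g, h) \<in> P" using that by (simp add: P_def)
    have "Min (insert 1 (\<epsilon> ` P)) \<le> \<epsilon> (g, h)" using fin x by (intro Min_le) auto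
    then show ?thesis using \<epsilon>(2)[OF x that(4)] by simp
  qed
  ultimately show ?thesis by blast
qed

text \<open>At radius \<open>r\<close> two translates of a point by distinct elements of a fixed word ball are at
  cone distance at least \<open>r \<epsilon>\<close>, where \<open>\<epsilon>\<close> separates the orbits in \<open>Y\<close>. Once \<open>r\<close> is large they
  cannot both be near the same point, so a short element that realises a warped distance is
  determined by the two points.\<close>

lemma near_translate_unique:
  "\<exists>R. \<forall>p\<in>OY. \<forall>q\<in>OY. \<forall>g\<in>ball_of N. \<forall>h\<in>ball_of N.
     R < fst p \<longrightarrow> \<kappa> * jd (act g p) q \<le> real N \<longrightarrow> \<kappa> * jd (act h p) q \<le> real N \<longrightarrow> g = h"
proof -
  obtain \<epsilon> where \<epsilon>: "\<epsilon> > 0"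
      "\<forall>g\<in>ball_of N. \<forall>h\<in>ball_of N. g \<noteq> h \<longrightarrow> (\<forall>y\<in>Y. \<epsilon> \<le> dist (\<phi> g y) (\<phi> h y))"
    using orbit_points_separated[of N] by blast
  have "g = h" if c: "p \<in> OY" "q \<in> OY" and gh: "g \<in> ball_of N" "h \<in> ball_of N"
    and R: "A * (2 * real N / \<kappa>) / \<epsilon> < fst p"
    and n: "\<kappa> * jd (act g p) q \<le> real N" "\<kappa> * jd (act h p) q \<le> real N" for p q g h
  proof (rule ccontr)
    assume "g \<noteq> h"
    then have "\<epsilon> \<le> dist (\<phi> g (snd p)) (\<phi> h (snd p))"
      using \<epsilon>(2) gh c(1) by (auto simp: infinite_cone_def)
    moreover have fp: "0 < fst p" using c(1) by (auto simp: infinite_cone_def)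
    ultimately have "fst p * \<epsilon> \<le> cone_dist Y (act g p) (act h p)"
      by (simp add: cone_dist_def cone_action_def)
    also have "\<dots> \<le> A * jd (act g p) (act h p)"
      using J_lower act_cone ball_carrier gh c by blast
    also have "jd (act g p) (act h p) \<le> jd (act g p) q + jd (act h p) q"
      by (rule dist_triangle2)
    also have "\<dots> \<le> 2 * real N / \<kappa>"
      using n \<kappa>_pos by (simp add: field_simps)
    finally have "fst p * \<epsilon> \<le> A * (2 * real N / \<kappa>)" using A_pos by simp
    moreover have "A * (2 * real N / \<kappa>) < fst p * \<epsilon>"
      using R by (simp only: pos_divide_less_eq[OF \<epsilon>(1)])
    ultimately show False by linarith
  qed
  then show ?thesis by blast
qed

end

section \<open>Control functions\<close>

text \<open>A generalised inverse of \<open>\<Phi>\<close>. It turns an upper bound for distances in terms of distances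
  of images into a lower control function.\<close>

lemma control_function_inverse:
  fixes \<Phi> :: "real \<Rightarrow> real"
  assumes mono: "mono_on {0..} \<Phi>" and unb: "\<And>T. \<exists>\<delta>\<ge>0. T \<le> \<Phi> \<delta>"
  shows "\<exists>\<rho>. control_function \<rho> \<and> (\<forall>T \<delta>. 0 \<le> \<delta> \<longrightarrow> T \<le> \<Phi> \<delta> \<longrightarrow> \<rho> T \<le> \<delta>)"
proof -
  define L where "L T = {\<delta>. 0 \<le> \<delta> \<and> T \<le> \<Phi> \<delta>}" for T
  define \<rho> where "\<rho> T = Inf (L T)" for T
  have ne: "L T \<noteq> {}" for T using unb[of T] by (auto simp: L_def)
  have bdd: "bdd_below (L T)" for T by (rule bdd_belowI[of _ 0]) (simp add: L_def)
  have "\<rho> T \<ge> 0" for T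
    unfolding \<rho>_def by (rule cInf_greatest[OF ne]) (simp add: L_def)
  moreover have "mono_on {0..} \<rho>"
    unfolding \<rho>_def by (intro mono_onI cInf_superset_mono ne bdd) (auto simp: L_def)
  moreover have "\<not> bdd_above (\<rho> ` {0..})"
  proof
    assume "bdd_above (\<rho> ` {0..})"
    then obtain R where R: "\<And>T. T \<ge> 0 \<Longrightarrow> \<rho> T \<le> R" by (auto simp: bdd_above_def)
    \<comment> \<open>At the argument \<open>T > \<Phi> R'\<close> the infimum is at least \<open>R' > R\<close>.\<close>
    define R' where "R' = max R 0 + 1"
    define T where "T = max 0 (\<Phi> R' + 1)"
    have "R' \<le> \<rho> T"
      unfolding \<rho>_def
    proof (rule cInf_greatest[OF ne])
      fix \<delta> assume "\<delta> \<in> L T"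
      then have \<delta>: "0 \<le> \<delta>" "\<Phi> R' < \<Phi> \<delta>" by (auto simp: L_def T_def)
      show "R' \<le> \<delta>"
      proof (rule ccontr)
        assume "\<not> R' \<le> \<delta>"
        then have "\<Phi> \<delta> \<le> \<Phi> R'" using \<delta>(1) by (intro mono_onD[OF mono]) auto
        then show False using \<delta>(2) by simp
      qed
    qed
    moreover have "\<rho> T \<le> R" by (rule R) (simp add: T_def)
    ultimately show False by (simp add: R'_def)
  qed
  moreover have "\<rho> T \<le> \<delta>" if "0 \<le> \<delta>" "T \<le> \<Phi> \<delta>" for T \<delta>
    unfolding \<rho>_def by (rule cInf_lower[OF _ bdd]) (simp add: L_def that)
  ultimately show ?thesis unfolding control_function_def by (intro exI[of _ \<rho>] conjI allI impI)
qed

lemma control_function_affine: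
  assumes "a > 0"
  shows "control_function (\<lambda>T. a * (T + 1))"
proof -
  have "\<not> bdd_above ((\<lambda>T. a * (T + 1)) ` {0..})"
  proof
    assume "bdd_above ((\<lambda>T. a * (T + 1)) ` {0..})"
    then obtain R where R: "\<And>T. T \<ge> 0 \<Longrightarrow> a * (T + 1) \<le> R" by (auto simp: bdd_above_def)
    have "a * (\<bar>R\<bar> / a + 1) \<le> R" using assms by (intro R) simp
    then show False using assms by (simp add: distrib_left)
  qed
  moreover have "mono_on {0..} (\<lambda>T. a * (T + 1))"
    using assms by (auto intro!: mono_onI)
  ultimately show ?thesis using assms by (auto simp: control_function_def)
qed

section \<open>The fibred coarse embedding\<close>

text \<open>The target of the coarse embedding. One section \<open>f\<close> serves for all \<open>n\<close>. The three twist
  estimates say that the distance from \<open>V g (f p)\<close> to \<open>f q\<close> records both how far \<open>g p\<close> is from \<open>q\<close>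
  and how long \<open>g\<close> is. In the Hilbert space it is the Pythagorean sum of these two quantities,
  the length of \<open>g\<close> being the norm of its translation part in a proper affine action.\<close>

locale twisted_cone = linearised_cone G S Y \<phi> J \<kappa> A
  for G (structure) and S :: "'a set" and Y :: "'y::metric_space set"
    and \<phi> :: "'a \<Rightarrow> 'y \<Rightarrow> 'y" and J :: "real \<times> 'y \<Rightarrow> 'e::metric_space"
    and \<kappa> A :: real +
  fixes V :: "'a \<Rightarrow> 'f::metric_space \<Rightarrow> 'f"
    and f :: "real \<times> 'y \<Rightarrow> 'f"
    and len :: "'a \<Rightarrow> real"
  assumes V_one: "V \<one> v = v"
    and V_mult: "\<lbrakk>g \<in> carrier G; h \<in> carrier G\<rbrakk> \<Longrightarrow> V (g \<otimes> h) v = V g (V h v)"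
    and V_isometry: "g \<in> carrier G \<Longrightarrow> dist (V g v) (V g w) = dist v w"
    and len_nonneg: "0 \<le> len g"
    and len_one: "len \<one> = 0"
    and len_mult: "\<lbrakk>g \<in> carrier G; h \<in> carrier G\<rbrakk> \<Longrightarrow> len (g \<otimes> h) \<le> len g + len h"
    and len_proper: "finite {g \<in> carrier G. len g \<le> r}"
    and twist_upper: "\<lbrakk>g \<in> carrier G; p \<in> infinite_cone Y; q \<in> infinite_cone Y\<rbrakk> \<Longrightarrow>
        dist (V g (f p)) (f q) \<le> dist (J (cone_action \<phi> g p)) (J q) + len g"
    and twist_lower_cone: "\<lbrakk>g \<in> carrier G; p \<in> infinite_cone Y; q \<in> infinite_cone Y\<rbrakk> \<Longrightarrow>
        dist (J (cone_action \<phi> g p)) (J q) \<le> dist (V g (f p)) (f q)"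
    and twist_lower_group: "\<lbrakk>g \<in> carrier G; p \<in> infinite_cone Y; q \<in> infinite_cone Y\<rbrakk> \<Longrightarrow>
        len g \<le> dist (V g (f p)) (f q)"
begin

lemma V_inv: "g \<in> carrier G \<Longrightarrow> V g (V (inv g) v) = v" "g \<in> carrier G \<Longrightarrow> V (inv g) (V g v) = v"
  using V_mult[of g "inv g" v] V_mult[of "inv g" g v] V_one by simp_all

lemma V_surj: "g \<in> carrier G \<Longrightarrow> range (V g) = UNIV"
  using V_inv(1) by (metis surjI)

lemma length_linear_bound: "\<exists>\<beta>\<ge>0. \<forall>k. \<forall>g\<in>ball_of k. len g \<le> \<beta> * real k"
proof -
  let ?T = "S \<union> m_inv G ` S"
  define \<beta> where "\<beta> = Max (insert 0 (len ` ?T))"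
  have fin: "finite (insert 0 (len ` ?T))" using fin_S by simp
  have \<beta>: "0 \<le> \<beta>" "\<And>s. s \<in> ?T \<Longrightarrow> len s \<le> \<beta>"
    unfolding \<beta>_def using fin by (auto intro!: Max_ge)
  have "g \<in> ball_of k \<Longrightarrow> len g \<le> \<beta> * real k" for k g
  proof (induction k arbitrary: g)
    case 0
    then show ?case by (simp add: len_one)
  next
    case (Suc k)
    from Suc.prems consider "g \<in> ball_of k"
      | h s where "h \<in> ball_of k" "s \<in> ?T" "g = h \<otimes> s" by auto
    then show ?case
    proof cases
      case 1
      then have "len g \<le> \<beta> * real k" by (rule Suc.IH)
      then show ?thesis using \<beta>(1) by (simp add: algebra_simps)
    next
      case 2
      have "s \<in> carrier G" using 2(2) S_carrier by auto
      then have "len g \<le> len h + len s" using len_mult ball_carrier 2 by blast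
      then show ?thesis using Suc.IH[OF 2(1)] \<beta>(2)[OF 2(2)] by (simp add: algebra_simps)
    qed
  qed
  then show ?thesis using \<beta>(1) by blast
qed

lemma short_elements_in_word_ball: "\<exists>k. {g \<in> carrier G. len g \<le> r} \<subseteq> ball_of k"
proof -
  have "\<forall>g\<in>{g \<in> carrier G. len g \<le> r}. \<exists>k. g \<in> ball_of k"
    using generate_word_ball[OF S_carrier] generating by blast
  then obtain k where k: "\<And>g. g \<in> carrier G \<Longrightarrow> len g \<le> r \<Longrightarrow> g \<in> ball_of (k g)"
    by (metis (mono_tags, lifting) mem_Collect_eq)
  let ?m = "Max (k ` {g \<in> carrier G. len g \<le> r})"
  have "g \<in> ball_of ?m" if "g \<in> carrier G" "len g \<le> r" for g
  proof -
    have "k g \<le> ?m" using that len_proper by (intro Max_ge) auto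
    then show ?thesis using k[OF that] word_ball_mono[of "k g" ?m G S] by blast
  qed
  then show ?thesis by blast
qed

text \<open>Properness gives the lower bound: if the images are at distance \<open>r\<close>, then \<open>g\<close> has length at
  most \<open>r\<close> and hence lies in a word ball \<open>N r\<close>, while it moves \<open>p\<close> to within \<open>r\<close> of \<open>q\<close>; so
  the warped distance is at most \<open>N r + A r\<close>, whichever element \<open>g\<close> is used.\<close>

lemma control_lower:
  "\<exists>\<rho>. control_function \<rho> \<and> (\<forall>p\<in>OY. \<forall>q\<in>OY. \<forall>g\<in>carrier G.
     \<rho> (wd p q) \<le> dist (V g (f p)) (f q))"
proof -
  define N where "N r = (LEAST k. {g \<in> carrier G. len g \<le> r} \<subseteq> ball_of k)" for r
  have N: "{g \<in> carrier G. len g \<le> r} \<subseteq> ball_of (N r)" for r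
    unfolding N_def by (rule LeastI_ex[OF short_elements_in_word_ball])
  have N_mono: "N r \<le> N r'" if "r \<le> r'" for r r'
    unfolding N_def[of r] using N[of r'] that by (intro Least_le) auto
  define \<Phi> where "\<Phi> r = real (N r) + A * r" for r
  have mono: "mono_on {0..} \<Phi>"
    unfolding \<Phi>_def using A_pos N_mono
    by (intro mono_onI add_mono mult_left_mono) auto
  have "\<exists>r\<ge>0. T \<le> \<Phi> r" for T
    using A_pos by (intro exI[of _ "\<bar>T\<bar> / A"]) (auto simp: \<Phi>_def)
  from control_function_inverse[OF mono this] obtain \<rho> where \<rho>: "control_function \<rho>"
    "\<And>T \<delta>. 0 \<le> \<delta> \<Longrightarrow> T \<le> \<Phi> \<delta> \<Longrightarrow> \<rho> T \<le> \<delta>" by blast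
  have "\<rho> (wd p q) \<le> dist (V g (f p)) (f q)" if c: "p \<in> OY" "q \<in> OY" and g: "g \<in> carrier G" for p q g
  proof (rule \<rho>(2))
    let ?\<delta> = "dist (V g (f p)) (f q)"
    have "g \<in> ball_of (N ?\<delta>)" using N[of ?\<delta>] twist_lower_group[OF g c] g by blast
    from wd_upper[OF c this] have "wd p q \<le> real (N ?\<delta>) + A * jd (act g p) q" .
    also have "\<dots> \<le> \<Phi> ?\<delta>"
      unfolding \<Phi>_def using twist_lower_cone[OF g c] A_pos by simp
    finally show "wd p q \<le> \<Phi> ?\<delta>" .
  qed simp
  with \<rho>(1) show ?thesis by blast
qed

text \<open>The elements that can realise a warped distance below \<open>n\<close> between \<open>x\<close> and \<open>p\<close>.\<close>

definition near :: "nat \<Rightarrow> real \<times> 'y \<Rightarrow> real \<times> 'y \<Rightarrow> 'a \<Rightarrow> bool" where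
  "near n x p g \<longleftrightarrow> g \<in> ball_of n \<and> \<kappa> * jd (act g x) p \<le> real n"

definition transporter :: "nat \<Rightarrow> real \<times> 'y \<Rightarrow> real \<times> 'y \<Rightarrow> 'a" where
  "transporter n x p = (SOME g. near n x p g)"

lemma near_transporter:
  assumes "x \<in> OY" "p \<in> OY" "wd x p < real n"
  shows "near n x p (transporter n x p)"
proof -
  obtain k g where g: "g \<in> ball_of k" and less: "real k + \<kappa> * jd (act g x) p < real n"
    using warped_dist_less[OF assms] by blast
  have "0 \<le> \<kappa> * jd (act g x) p" using \<kappa>_pos by simp
  then have "real k \<le> real n" "\<kappa> * jd (act g x) p \<le> real n" using less by linarith+
  then have "near n x p g" using g word_ball_mono[of k n G S] by (auto simp: near_def)
  then show ?thesis unfolding transporter_def by (rule someI)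
qed

lemma near_carrier: "near n x p g \<Longrightarrow> g \<in> carrier G"
  using ball_carrier by (auto simp: near_def)

lemma near_radius:
  assumes c: "x \<in> OY" "p \<in> OY" and g: "near n x p g"
  shows "fst x - A / diameter Y * (real n / \<kappa>) \<le> fst p"
proof -
  have "jd (act g x) p \<le> real n / \<kappa>" using g \<kappa>_pos by (simp add: near_def field_simps)
  then have "A / diameter Y * jd (act g x) p \<le> A / diameter Y * (real n / \<kappa>)"
    using A_pos diam_pos by (intro mult_left_mono) auto
  then show ?thesis
    using radius_diff_le[OF act_cone[OF near_carrier[OF g] c(1)] c(2)] fst_act[of g x] by simp
qed

text \<open>Two points of one ball are compared through its centre \<open>x\<close>. By invariance the errors of \<open>g\<close> and
  \<open>h\<close> add up, which gives the factor \<open>2\<close>.\<close>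

lemma near_common_source:
  assumes c: "x \<in> OY" "p \<in> OY" "q \<in> OY" and g: "near n x p g" and h: "near n x q h"
  shows "near (2 * n) p q (h \<otimes> inv g)"
proof -
  note gh = near_carrier[OF g] near_carrier[OF h]
  have "h \<otimes> inv g \<in> ball_of (n + n)"
    using g h by (intro word_ball_mult[OF S_carrier] word_ball_inv[OF S_carrier]) (auto simp: near_def)
  moreover have "jd (act (h \<otimes> inv g) p) q \<le> jd (act g x) p + jd (act h x) q"
  proof -
    have "jd (act (h \<otimes> inv g) p) q \<le> jd (act h (act (inv g) p)) (act h x) + jd (act h x) q"
      using act_mult[of h "inv g" p] gh c dist_triangle by (metis inv_closed)
    also have "jd (act h (act (inv g) p)) (act h x) = jd (act (inv g) p) x"
      using gh c by (intro J_invariant act_cone) auto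
    also have "\<dots> = jd (act g x) p" using jd_inv gh c by (simp add: dist_commute)
    finally show ?thesis .
  qed
  then have "\<kappa> * jd (act (h \<otimes> inv g) p) q \<le> \<kappa> * (jd (act g x) p + jd (act h x) q)"
    using \<kappa>_pos by simp
  moreover have "\<dots> \<le> real (n + n)"
    using g h unfolding near_def distrib_left of_nat_add by (intro add_mono) blast+
  ultimately show ?thesis unfolding near_def mult_2 by (blast intro: order_trans)
qed

text \<open>The analogous statement for the centres of two balls that share the point \<open>p\<close>.\<close>

lemma near_common_target:
  assumes c: "x \<in> OY" "x' \<in> OY" "p \<in> OY" and g: "near n x p g" and h: "near n x' p h"
  shows "near (2 * n) x' x (inv g \<otimes> h)"
proof -
  note gh = near_carrier[OF g] near_carrier[OF h]
  have rev: "near n p y (inv k)" if "near n y p k" "y \<in> OY" for y k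
    using that word_ball_inv[OF S_carrier] jd_inv[OF near_carrier[OF that(1)] c(3) that(2)]
    by (simp add: near_def dist_commute)
  from near_common_source[OF c(3,2,1) rev[OF h c(2)] rev[OF g c(1)]] show ?thesis
    using gh by simp
qed

text \<open>On the ball about \<open>x\<close> the fibre over \<open>p\<close> is identified with the model space through the inverse
  of the element \<open>\<gamma> x p\<close> that carries \<open>x\<close> near \<open>p\<close>. Distances in this trivialisation become
  twist distances for \<open>\<gamma> x q \<otimes> inv (\<gamma> x p)\<close>, which carries \<open>p\<close> near \<open>q\<close>. For two centres \<open>x\<close>
  and \<open>x'\<close> the change of trivialisation over \<open>p\<close> is the action of \<open>inv (\<gamma> x p) \<otimes> \<gamma> x' p\<close>, which
  carries \<open>x'\<close> near \<open>x\<close>. By uniqueness of such elements it is the same for all \<open>p\<close> in the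
  intersection.\<close>

theorem fibred_coarse_embedding_twisted:
  "fibred_coarse_embedding (warped_cone S Y \<phi>) (euclidean_metric :: 'f metric)"
proof -
  let ?X = "warped_cone S Y \<phi>"
  note X = warped_cone_simps[OF compact_Y diam_pos, of S \<phi>]
  obtain \<rho>\<^sub>m where \<rho>m: "control_function \<rho>\<^sub>m"
    "\<And>p q g. p \<in> OY \<Longrightarrow> q \<in> OY \<Longrightarrow> g \<in> carrier G \<Longrightarrow> \<rho>\<^sub>m (wd p q) \<le> dist (V g (f p)) (f q)"
    using control_lower by blast
  obtain \<beta> where \<beta>: "\<beta> \<ge> 0" "\<And>k g. g \<in> ball_of k \<Longrightarrow> len g \<le> \<beta> * real k"
    using length_linear_bound by blast
  define \<rho>\<^sub>p where "\<rho>\<^sub>p = (\<lambda>T. (1 / \<kappa> + \<beta>) * (T + 1))"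
  have \<rho>p: "control_function \<rho>\<^sub>p"
    unfolding \<rho>\<^sub>p_def using \<beta>(1) \<kappa>_pos by (intro control_function_affine add_pos_nonneg) auto
  have level: "\<exists>K \<tau>. K \<subseteq> OY \<and> Metric_space.mbounded OY wd K \<and>
           (\<forall>x \<in> OY - K.
              trivialisation (mball_of ?X x (real n)) (\<lambda>_. euclidean_metric) euclidean_metric (\<tau> x) \<and>
              (\<forall>p \<in> mball_of ?X x (real n). \<forall>q \<in> mball_of ?X x (real n).
                 let \<delta> = dist (snd (\<tau> x (p, f p))) (snd (\<tau> x (q, f q)))
                 in \<rho>\<^sub>m (wd p q) \<le> \<delta> \<and> \<delta> \<le> \<rho>\<^sub>p (wd p q))) \<and>
           (\<forall>x \<in> OY - K. \<forall>x' \<in> OY - K.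
              let I = mball_of ?X x (real n) \<inter> mball_of ?X x' (real n)
              in I \<noteq> {} \<longrightarrow>
                 (\<exists>t. isometry_onto (euclidean_metric :: 'f metric) (euclidean_metric :: 'f metric) t \<and>
                    (\<forall>p \<in> I \<times> UNIV.
                       \<tau> x (inv_into (total_space (mball_of ?X x' (real n)) (\<lambda>_. euclidean_metric)) (\<tau> x') p)
                         = map_prod id t p)))"
    (is "\<exists>K \<tau>. ?P K \<tau>") for n
  proof -
    \<comment> \<open>Two points of a ball of radius \<open>n\<close> are at distance below \<open>2 * n\<close>; the extra \<open>1\<close> is the
      slack in approximating a warped distance by the cost of a single group element.\<close>
    define N where "N = 2 * n + 1"
    obtain R where "\<forall>p\<in>OY. \<forall>q\<in>OY. \<forall>g\<in>ball_of N. \<forall>h\<in>ball_of N. R < fst p \<longrightarrow>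
        \<kappa> * jd (act g p) q \<le> real N \<longrightarrow> \<kappa> * jd (act h p) q \<le> real N \<longrightarrow> g = h"
      using near_translate_unique[of N] by (elim exE)
    note R = this[rule_format]
    \<comment> \<open>Points of a ball of radius \<open>n\<close> can be closer to the apex than its centre; the second
      summand bounds that loss, so that all of them have radius above \<open>R\<close>.\<close>
    define K where "K = {p \<in> OY. fst p \<le> \<bar>R\<bar> + A / diameter Y * (real n / \<kappa>)}"
    define \<gamma> where "\<gamma> = transporter n"
    define \<tau> where "\<tau> = (\<lambda>x (p, v :: 'f). (p, V (inv (\<gamma> x p)) v))"
    have \<tau>: "\<tau> x (p, v) = (p, V (inv (\<gamma> x p)) v)" for x p v by (simp add: \<tau>_def)
    have in_ball: "p \<in> mball_of ?X x (real n) \<longleftrightarrow> x \<in> OY \<and> p \<in> OY \<and> wd x p < real n" for x p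
      by (simp add: X)
    have \<gamma>: "near n x p (\<gamma> x p)" if "p \<in> mball_of ?X x (real n)" for x p
      using that near_transporter unfolding in_ball \<gamma>_def by blast
    have \<gamma>c: "\<gamma> x p \<in> carrier G" if "p \<in> mball_of ?X x (real n)" for x p
      using near_carrier[OF \<gamma>[OF that]] .
    have near_unique: "g = h"
      if "p \<in> OY" "q \<in> OY" "R < fst p" "near (2 * n) p q g"
        "h \<in> ball_of N" "\<kappa> * jd (act h p) q \<le> real N" for p q g h
    proof (rule R[OF that(1,2) _ that(5,3) _ that(6)])
      show "g \<in> ball_of N"
        using that(4) word_ball_mono[of "2 * n" N G S] by (auto simp: near_def N_def)
      show "\<kappa> * jd (act g p) q \<le> real N"
        using that(4) by (simp add: near_def N_def)
    qed
    have large: "R < fst p" if "x \<in> OY - K" "p \<in> mball_of ?X x (real n)" for x p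
      using that near_radius[OF _ _ \<gamma>[OF that(2)]] unfolding in_ball K_def by force
    have triv: "trivialisation (mball_of ?X x (real n)) (\<lambda>_. euclidean_metric) euclidean_metric (\<tau> x)" for x
      unfolding trivialisation_def isometry_onto_def
    proof (intro ballI conjI)
      fix p assume p: "p \<in> mball_of ?X x (real n)"
      note inv_c = inv_closed[OF \<gamma>c[OF p]]
      show "\<tau> x ` ({p} \<times> mspace euclidean_metric) = {p} \<times> mspace euclidean_metric"
        using V_surj[OF inv_c] by (force simp: \<tau> image_iff)
      show "(\<lambda>v. snd (\<tau> x (p, v))) ` mspace euclidean_metric = mspace euclidean_metric"
        using V_surj[OF inv_c] by (simp add: \<tau>)
    next
      fix p and u v :: 'f assume p: "p \<in> mball_of ?X x (real n)"
      show "mdist euclidean_metric (snd (\<tau> x (p, u))) (snd (\<tau> x (p, v))) = mdist euclidean_metric u v"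
        using V_isometry[OF inv_closed[OF \<gamma>c[OF p]]] by (simp add: \<tau>)
    qed
    have control: "\<rho>\<^sub>m (wd p q) \<le> dist (snd (\<tau> x (p, f p))) (snd (\<tau> x (q, f q))) \<and>
        dist (snd (\<tau> x (p, f p))) (snd (\<tau> x (q, f q))) \<le> \<rho>\<^sub>p (wd p q)"
      if x: "x \<in> OY - K" and p: "p \<in> mball_of ?X x (real n)" and q: "q \<in> mball_of ?X x (real n)"
      for x p q
    proof -
      define g where "g = \<gamma> x q \<otimes> inv (\<gamma> x p)"
      have c: "x \<in> OY" "p \<in> OY" "q \<in> OY" using p q unfolding in_ball by auto
      have near_g: "near (2 * n) p q g"
        unfolding g_def by (rule near_common_source[OF c \<gamma>[OF p] \<gamma>[OF q]])
      note gc = near_carrier[OF near_g]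
      have "dist (snd (\<tau> x (p, f p))) (snd (\<tau> x (q, f q)))
          = dist (V (\<gamma> x q) (V (inv (\<gamma> x p)) (f p))) (V (\<gamma> x q) (V (inv (\<gamma> x q)) (f q)))"
        unfolding \<tau> snd_conv by (rule V_isometry[OF \<gamma>c[OF q], symmetric])
      also have "\<dots> = dist (V g (f p)) (f q)"
        unfolding g_def using V_mult V_inv \<gamma>c p q by simp
      finally have eq: "dist (snd (\<tau> x (p, f p))) (snd (\<tau> x (q, f q))) = dist (V g (f p)) (f q)" .
      have "wd p q \<le> wd p x + wd x q" by (rule Metric_space.triangle[OF Metric_space_wd c(2,1,3)])
      also have "wd p x = wd x p" by (rule Metric_space.commute[OF Metric_space_wd])
      finally have small: "wd p q + 1 < real N"
        using p q unfolding in_ball by (simp add: N_def)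
      have "wd p q < wd p q + 1" by simp
      then obtain k h where h: "h \<in> ball_of k" and cost: "real k + \<kappa> * jd (act h p) q < wd p q + 1"
        using warped_dist_less[OF c(2,3)] by blast
      have pos: "0 \<le> \<kappa> * jd (act h p) q" using \<kappa>_pos by simp
      then have "k \<le> N" using cost small by linarith
      \<comment> \<open>The element \<open>h\<close> realises the distance of \<open>p\<close> and \<open>q\<close> almost optimally, whereas \<open>g\<close> comes from
        the trivialisation and is a priori bounded only in terms of \<open>n\<close>. Their equality makes
        the upper control independent of \<open>n\<close>.\<close>
      have "g = h"
      proof (rule near_unique[OF c(2,3) large[OF x p] near_g])
        show "h \<in> ball_of N" using h word_ball_mono[OF \<open>k \<le> N\<close>, of G S] by blast
        show "\<kappa> * jd (act h p) q \<le> real N" using cost small by linarith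
      qed
      have "dist (V g (f p)) (f q) \<le> jd (act g p) q + len g" by (rule twist_upper[OF gc c(2,3)])
      also have "\<dots> \<le> (wd p q + 1) / \<kappa> + \<beta> * (wd p q + 1)"
      proof (rule add_mono)
        have "\<kappa> * jd (act g p) q \<le> wd p q + 1" using cost \<open>g = h\<close> by simp
        then show "jd (act g p) q \<le> (wd p q + 1) / \<kappa>" using \<kappa>_pos by (simp add: field_simps)
        have "len g \<le> \<beta> * real k" using \<beta>(2) h \<open>g = h\<close> by blast
        also have "\<dots> \<le> \<beta> * (wd p q + 1)" using \<beta>(1) cost pos by (intro mult_left_mono) auto
        finally show "len g \<le> \<beta> * (wd p q + 1)" .
      qed
      also have "\<dots> = \<rho>\<^sub>p (wd p q)" by (simp add: \<rho>\<^sub>p_def field_simps)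
      finally show ?thesis using \<rho>m(2)[OF c(2,3) gc] eq by simp
    qed
    have transition: "\<exists>t. isometry_onto (euclidean_metric :: 'f metric) (euclidean_metric :: 'f metric) t \<and>
        (\<forall>p \<in> (mball_of ?X x (real n) \<inter> mball_of ?X x' (real n)) \<times> UNIV.
           \<tau> x (inv_into (total_space (mball_of ?X x' (real n)) (\<lambda>_. euclidean_metric)) (\<tau> x') p)
             = map_prod id t p)"
      if x: "x \<in> OY - K" "x' \<in> OY - K"
        and I: "mball_of ?X x (real n) \<inter> mball_of ?X x' (real n) \<noteq> {}" for x x'
    proof -
      let ?I = "mball_of ?X x (real n) \<inter> mball_of ?X x' (real n)"
      let ?T = "total_space (mball_of ?X x' (real n)) (\<lambda>_. euclidean_metric :: 'f metric)"
      obtain p where p: "p \<in> ?I" using I by blast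
      define g where "g = inv (\<gamma> x p) \<otimes> \<gamma> x' p"
      have near_g: "near (2 * n) x' x (inv (\<gamma> x q) \<otimes> \<gamma> x' q)" if "q \<in> ?I" for q
      proof -
        have "x \<in> OY" "x' \<in> OY" "q \<in> OY" using that unfolding Int_iff in_ball by auto
        then show ?thesis using that by (intro near_common_target[where p = q] \<gamma>) (simp_all only: Int_iff)
      qed
      have Rx': "R < fst x'"
      proof -
        have "0 \<le> A / diameter Y * (real n / \<kappa>)" using A_pos diam_pos \<kappa>_pos by simp
        then show ?thesis using x(2) by (auto simp: K_def)
      qed
      have const: "inv (\<gamma> x q) \<otimes> \<gamma> x' q = g" if "q \<in> ?I" for q
      proof (rule near_unique[OF _ _ Rx' near_g[OF that]])
        show "g \<in> ball_of N" "\<kappa> * jd (act g x') x \<le> real N"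
          using near_g[OF p] word_ball_mono[of "2 * n" N G S] by (auto simp: near_def N_def g_def)
      qed (use x in auto)
      have gc: "g \<in> carrier G" using near_carrier[OF near_g[OF p]] by (simp add: g_def)
      have inj: "inj_on (\<tau> x') ?T"
      proof (rule inj_onI)
        fix a b assume ab: "a \<in> ?T" "b \<in> ?T" "\<tau> x' a = \<tau> x' b"
        obtain q u r v where qr: "a = (q, u)" "b = (r, v)" by fastforce
        have "q = r" and eq: "V (inv (\<gamma> x' q)) u = V (inv (\<gamma> x' q)) v"
          using ab(3) by (auto simp: qr \<tau>)
        have "\<gamma> x' q \<in> carrier G" using ab(1) by (intro \<gamma>c) (simp add: total_space_def qr)
        then have "u = v" using eq V_inv(1) by metis
        then show "a = b" using qr \<open>q = r\<close> by simp
      qed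
      have "\<tau> x (inv_into ?T (\<tau> x') (q, v)) = map_prod id (V g) (q, v)" if q: "q \<in> ?I" for q v
      proof -
        have qx: "q \<in> mball_of ?X x (real n)" "q \<in> mball_of ?X x' (real n)" using q by auto
        have "\<tau> x' (q, V (\<gamma> x' q) v) = (q, v)"
          using V_inv(2)[OF \<gamma>c[OF qx(2)]] by (simp add: \<tau>)
        moreover have "(q, V (\<gamma> x' q) v) \<in> ?T" using qx by (simp add: total_space_def)
        ultimately have "inv_into ?T (\<tau> x') (q, v) = (q, V (\<gamma> x' q) v)"
          using inv_into_f_eq[OF inj] by blast
        then show ?thesis
          using V_mult[OF inv_closed[OF \<gamma>c[OF qx(1)]] \<gamma>c[OF qx(2)], of v] const[OF q]
          by (simp add: \<tau>)
      qed
      moreover have "isometry_onto euclidean_metric euclidean_metric (V g)"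
        using V_surj[OF gc] V_isometry[OF gc] by (simp add: isometry_onto_def)
      ultimately show ?thesis by (intro exI[of _ "V g"]) auto
    qed
    have "?P K \<tau>"
      unfolding Let_def using triv control transition bounded_radius_mbounded
      by (intro conjI ballI impI) (auto simp: K_def)
    then show ?thesis by blast
  qed
  show ?thesis
    unfolding fibred_coarse_embedding_def X mspace_euclidean_metric mdist_euclidean_metric
  proof (rule exI[of _ "\<lambda>_. euclidean_metric"], rule exI[of _ "\<lambda>_. f"],
      rule exI[of _ "\<rho>\<^sub>m"], rule exI[of _ "\<rho>\<^sub>p"], intro conjI)
    have "isometry_onto euclidean_metric (euclidean_metric :: 'f metric) id"
      by (simp add: isometry_onto_def)
    then show "\<forall>x\<in>OY. \<exists>j. isometry_onto (euclidean_metric :: 'f metric) (euclidean_metric :: 'f metric) j"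
      by blast
    show "control_function \<rho>\<^sub>m" "control_function \<rho>\<^sub>p" by (fact \<rho>m(1) \<rho>p)+
  qed (simp, rule allI, rule level)
qed

end

section \<open>Bi-Lipschitz embedding of the cone\<close>

definition cone_map :: "('y \<Rightarrow> 'h::real_normed_vector) \<Rightarrow> real \<times> 'y \<Rightarrow> 'h \<times> real" where
  "cone_map \<iota> p = (fst p *\<^sub>R \<iota> (snd p), fst p)"

text \<open>Scaling \<open>\<iota>\<close> by the radius reproduces the second term of the cone metric. The error from scaling
  by two different radii is at most the difference of the radii times a bound for \<open>\<iota>\<close>, and the
  second coordinate controls that difference.\<close>

lemma cone_map_bi_Lipschitz:
  fixes \<iota> :: "'y::metric_space \<Rightarrow> 'h::real_normed_vector"
  assumes Y: "compact Y" "diameter Y > 0" and \<iota>: "bi_Lipschitz_embedding Y \<iota>"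
  shows "\<exists>\<kappa>>0. \<exists>A>0. \<forall>p\<in>infinite_cone Y. \<forall>q\<in>infinite_cone Y.
    \<kappa> * dist (cone_map \<iota> p) (cone_map \<iota> q) \<le> cone_dist Y p q \<and>
    cone_dist Y p q \<le> A * dist (cone_map \<iota> p) (cone_map \<iota> q)"
proof -
  let ?D = "diameter Y"
  obtain c C where c: "c > 0" "C > 0"
    and lip: "\<And>x y. x \<in> Y \<Longrightarrow> y \<in> Y \<Longrightarrow> c * dist x y \<le> dist (\<iota> x) (\<iota> y)"
      "\<And>x y. x \<in> Y \<Longrightarrow> y \<in> Y \<Longrightarrow> dist (\<iota> x) (\<iota> y) \<le> C * dist x y"
    using \<iota> unfolding bi_Lipschitz_embedding_def by blast
  have "C-lipschitz_on Y \<iota>" using lip(2) c(2) by (intro lipschitz_onI) auto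
  then have "bounded (\<iota> ` Y)"
    using Y(1) by (intro compact_imp_bounded compact_continuous_image lipschitz_on_continuous_on)
  then obtain M where M: "M > 0" "\<And>y. y \<in> Y \<Longrightarrow> norm (\<iota> y) \<le> M"
    unfolding bounded_pos by auto
  define B where "B = C + (M + 1) / ?D"
  define A where "A = ?D + (1 + M) / c"
  have B: "B > 0" using c M Y(2) by (simp add: B_def add_pos_nonneg)
  have A: "A > 0" using c M Y(2) by (simp add: A_def add_pos_nonneg)
  have ordered: "dist (cone_map \<iota> p) (cone_map \<iota> q) \<le> B * cone_dist Y p q \<and>
      cone_dist Y p q \<le> A * dist (cone_map \<iota> p) (cone_map \<iota> q)"
    if pq: "p \<in> infinite_cone Y" "q \<in> infinite_cone Y" and le: "fst p \<le> fst q" for p q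
  proof -
    obtain a x b y where p: "p = (a, x)" and q: "q = (b, y)" by fastforce
    have ab: "0 < a" "a \<le> b" and xy: "x \<in> Y" "y \<in> Y"
      using pq le by (auto simp: p q infinite_cone_def)
    let ?u = "a *\<^sub>R \<iota> x - b *\<^sub>R \<iota> y"
    let ?J = "dist (cone_map \<iota> p) (cone_map \<iota> q)"
    \<comment> \<open>Splitting at the smaller radius matches the minimum in the cone metric.\<close>
    have split: "?u = a *\<^sub>R (\<iota> x - \<iota> y) - (b - a) *\<^sub>R \<iota> y" by (simp add: algebra_simps)
    have n1: "norm (a *\<^sub>R (\<iota> x - \<iota> y)) = a * dist (\<iota> x) (\<iota> y)"
      using ab by (simp add: dist_norm)
    have n2: "norm ((b - a) *\<^sub>R \<iota> y) \<le> (b - a) * M"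
      using ab M(2)[OF xy(2)] by (auto intro: mult_left_mono)
    have cd: "cone_dist Y p q = (b - a) * ?D + a * dist x y"
      using ab by (simp add: cone_dist_def p q)
    have u: "norm ?u \<le> ?J" "b - a \<le> ?J"
      using dist_fst_le[of "cone_map \<iota> p" "cone_map \<iota> q"] dist_snd_le[of "cone_map \<iota> p" "cone_map \<iota> q"]
      by (auto simp: cone_map_def p q dist_norm)
    have "?J \<le> norm ?u + \<bar>a - b\<bar>"
      using norm_Pair_le[of ?u "a - b"] by (simp add: cone_map_def p q dist_norm)
    also have "norm ?u \<le> a * dist (\<iota> x) (\<iota> y) + (b - a) * M"
      unfolding split using norm_triangle_ineq4 n1 n2 by (smt (verit))
    also have "a * dist (\<iota> x) (\<iota> y) \<le> a * (C * dist x y)"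
      using ab lip(2)[OF xy] by (intro mult_left_mono) auto
    finally have "?J \<le> C * (a * dist x y) + (M + 1) * (b - a)"
      using ab by (simp add: algebra_simps)
    also have "(M + 1) * (b - a) = (M + 1) / ?D * ((b - a) * ?D)" using Y(2) by simp
    also have "C * (a * dist x y) + \<dots> \<le> B * (a * dist x y) + B * ((b - a) * ?D)"
      using ab c M Y(2) unfolding B_def by (intro add_mono mult_right_mono) auto
    finally have upper: "?J \<le> B * cone_dist Y p q" by (simp add: cd distrib_left)
    have "c * (a * dist x y) \<le> a * dist (\<iota> x) (\<iota> y)"
      using ab lip(1)[OF xy] mult_left_mono[of "c * dist x y" "dist (\<iota> x) (\<iota> y)" a]
      by (simp add: algebra_simps)
    also have "\<dots> \<le> norm ?u + (b - a) * M"
      unfolding n1[symmetric] using n2 norm_triangle_sub[of "a *\<^sub>R (\<iota> x - \<iota> y)" ?u] split by simp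
    also have "\<dots> \<le> ?J + ?J * M" using u M by (intro add_mono mult_right_mono) auto
    finally have "a * dist x y \<le> (1 + M) / c * ?J" using c by (simp add: field_simps)
    moreover have "(b - a) * ?D \<le> ?J * ?D" using u(2) Y(2) by (intro mult_right_mono) auto
    ultimately have "cone_dist Y p q \<le> A * ?J" by (simp add: cd A_def algebra_simps)
    with upper show ?thesis by blast
  qed
  have both: "dist (cone_map \<iota> p) (cone_map \<iota> q) \<le> B * cone_dist Y p q \<and>
      cone_dist Y p q \<le> A * dist (cone_map \<iota> p) (cone_map \<iota> q)"
    if "p \<in> infinite_cone Y" "q \<in> infinite_cone Y" for p q
    using ordered[OF that] ordered[OF that(2,1)]
    by (cases "fst p \<le> fst q") (auto simp: dist_commute cone_dist_commute)
  show ?thesis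
    using both A B
    by (intro exI[of _ "1 / B"] exI[of _ A] conjI ballI) (auto simp: field_simps)
qed

section \<open>Isometric actions on Hilbert spaces\<close>

lemma group_action_UNIV_one: "group_action G UNIV \<psi> \<Longrightarrow> \<psi> \<one>\<^bsub>G\<^esub> v = v"
  using group_action.id_eq_one[of G UNIV \<psi>] by (metis restrict_apply' UNIV_I)

lemma group_action_UNIV_mult:
  "\<lbrakk>group_action G UNIV \<psi>; g \<in> carrier G; h \<in> carrier G\<rbrakk> \<Longrightarrow> \<psi> (g \<otimes>\<^bsub>G\<^esub> h) v = \<psi> g (\<psi> h v)"
  by (rule group_action.composition_rule[of G UNIV \<psi>]) auto

lemma isometric_representation_dist:
  assumes "isometric_representation G \<pi>" "g \<in> carrier G"
  shows "dist (\<pi> g u) (\<pi> g v) = dist u v"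
proof -
  have "linear (\<pi> g)" "\<And>w. norm (\<pi> g w) = norm w"
    using assms by (auto simp: isometric_representation_def)
  then show ?thesis by (metis dist_norm linear_diff)
qed

theorem theoremB:
  fixes G :: "('g, 'm) monoid_scheme"
    and S :: "'g set"
    and Y :: "'y::metric_space set"
    and \<phi> :: "'g \<Rightarrow> 'y \<Rightarrow> 'y"
  assumes "group G"
    and "finite S" and "S \<subseteq> carrier G" and "generate G S = carrier G"
    and "compact Y" and "diameter Y > 0"
    and "continuous_action G Y \<phi>"
    and "free_action G Y \<phi>"
    and "linearisable G Y \<phi> TYPE('h::{real_inner,banach})"
    and "a_T_menable G TYPE('k::{real_inner,banach})"
  shows "\<exists>H :: ('h \<times> 'k \<times> real) inner_module.
           hilbert_space H \<and>
           fibred_coarse_embedding (warped_cone S Y \<phi>) (hilbert_metric H)"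
proof -
  obtain \<pi> :: "'g \<Rightarrow> 'h \<Rightarrow> 'h" and \<iota> :: "'y \<Rightarrow> 'h" where \<pi>: "isometric_representation G \<pi>"
    and \<iota>: "bi_Lipschitz_embedding Y \<iota>"
    and equivariant: "\<And>g y. g \<in> carrier G \<Longrightarrow> y \<in> Y \<Longrightarrow> \<iota> (\<phi> g y) = \<pi> g (\<iota> y)"
    using assms(9) unfolding linearisable_def by blast
  obtain \<alpha> :: "'g \<Rightarrow> 'k \<Rightarrow> 'k" where \<alpha>: "isometric_affine_action G \<alpha>"
    and proper: "\<And>v w r. finite {g \<in> carrier G. \<alpha> g v \<in> cball w r}"
    using assms(10) unfolding a_T_menable_def by blast
  obtain \<kappa> A where \<kappa>: "\<kappa> > 0" and A: "A > 0"
    and compare: "\<And>p q. p \<in> infinite_cone Y \<Longrightarrow> q \<in> infinite_cone Y \<Longrightarrow>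
        \<kappa> * dist (cone_map \<iota> p) (cone_map \<iota> q) \<le> cone_dist Y p q \<and>
        cone_dist Y p q \<le> A * dist (cone_map \<iota> p) (cone_map \<iota> q)"
    using cone_map_bi_Lipschitz[OF assms(5,6) \<iota>] by blast
  have \<pi>_action: "group_action G UNIV \<pi>" using \<pi> by (simp add: isometric_representation_def)
  have \<alpha>_action: "group_action G UNIV \<alpha>" using \<alpha> by (simp add: isometric_affine_action_def)
  have \<alpha>_dist: "dist (\<alpha> g v) (\<alpha> g w) = dist v w" if "g \<in> carrier G" for g v w
    using \<alpha> that by (simp add: isometric_affine_action_def)
  note \<pi>_dist = isometric_representation_dist[OF \<pi>]
  \<comment> \<open>The affine action enters the representation but not the section, so that the distance
    from \<open>V g (f p)\<close> to \<open>f q\<close> sees the translation part of \<open>g\<close>.\<close>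
  define V where "V = (\<lambda>g. map_prod (\<pi> g) (map_prod (\<alpha> g) (id :: real \<Rightarrow> real)))"
  define f where "f p = (fst p *\<^sub>R \<iota> (snd p), 0 :: 'k, fst p)" for p
  define len where "len g = norm (\<alpha> g 0)" for g
  have \<pi>_cone_map: "cone_map \<iota> (cone_action \<phi> g p) = (\<pi> g (fst p *\<^sub>R \<iota> (snd p)), fst p)"
    if "g \<in> carrier G" "p \<in> infinite_cone Y" for g p
  proof -
    have "linear (\<pi> g)" using \<pi> that by (simp add: isometric_representation_def)
    then show ?thesis
      using that equivariant
      by (auto simp: cone_map_def cone_action_def infinite_cone_def linear_scale)
  qed
  have twist: "dist (V g (f p)) (f q)
      = sqrt ((dist (cone_map \<iota> (cone_action \<phi> g p)) (cone_map \<iota> q))\<^sup>2 + (len g)\<^sup>2)"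
    if "g \<in> carrier G" "p \<in> infinite_cone Y" for g p q
    unfolding \<pi>_cone_map[OF that]
    by (simp add: V_def f_def len_def cone_map_def dist_Pair_Pair)
  interpret group G by fact
  interpret twisted_cone G S Y \<phi> "cone_map \<iota>" \<kappa> A V f len
  proof
    show "finite S" "S \<subseteq> carrier G" "generate G S = carrier G" "compact Y" "0 < diameter Y"
      "continuous_action G Y \<phi>" "free_action G Y \<phi>" "0 < \<kappa>" "0 < A" by fact+
    show "\<kappa> * dist (cone_map \<iota> p) (cone_map \<iota> q) \<le> cone_dist Y p q"
      "cone_dist Y p q \<le> A * dist (cone_map \<iota> p) (cone_map \<iota> q)"
      if "p \<in> infinite_cone Y" "q \<in> infinite_cone Y" for p q
      using compare[OF that] by auto
    show "dist (cone_map \<iota> (cone_action \<phi> g p)) (cone_map \<iota> (cone_action \<phi> g q))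
        = dist (cone_map \<iota> p) (cone_map \<iota> q)"
      if "g \<in> carrier G" "p \<in> infinite_cone Y" "q \<in> infinite_cone Y" for g p q
      unfolding \<pi>_cone_map[OF that(1,2)] \<pi>_cone_map[OF that(1,3)]
      by (simp add: cone_map_def dist_Pair_Pair \<pi>_dist[OF that(1)])
    show "V \<one>\<^bsub>G\<^esub> v = v" for v
      by (cases v) (simp add: V_def group_action_UNIV_one[OF \<pi>_action] group_action_UNIV_one[OF \<alpha>_action])
    show "V (g \<otimes>\<^bsub>G\<^esub> h) v = V g (V h v)" if "g \<in> carrier G" "h \<in> carrier G" for g h v
      by (cases v) (simp add: V_def group_action_UNIV_mult[OF \<pi>_action that]
          group_action_UNIV_mult[OF \<alpha>_action that])
    show "dist (V g v) (V g w) = dist v w" if "g \<in> carrier G" for g v w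
      by (cases v; cases w) (simp add: V_def dist_Pair_Pair \<pi>_dist[OF that] \<alpha>_dist[OF that])
    show "0 \<le> len g" for g by (simp add: len_def)
    show "len \<one>\<^bsub>G\<^esub> = 0" by (simp add: len_def group_action_UNIV_one[OF \<alpha>_action])
    show "len (g \<otimes>\<^bsub>G\<^esub> h) \<le> len g + len h" if "g \<in> carrier G" "h \<in> carrier G" for g h
    proof -
      have "len (g \<otimes>\<^bsub>G\<^esub> h) = dist (\<alpha> g (\<alpha> h 0)) 0"
        by (simp add: len_def group_action_UNIV_mult[OF \<alpha>_action that])
      also have "\<dots> \<le> dist (\<alpha> g (\<alpha> h 0)) (\<alpha> g 0) + dist (\<alpha> g 0) 0"
        by (rule dist_triangle)
      finally show ?thesis by (simp add: \<alpha>_dist[OF that(1)] len_def)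
    qed
    show "finite {g \<in> carrier G. len g \<le> r}" for r
      using proper[of 0 0 r] by (simp add: len_def)
    show "dist (V g (f p)) (f q)
        \<le> dist (cone_map \<iota> (cone_action \<phi> g p)) (cone_map \<iota> q) + len g"
      "dist (cone_map \<iota> (cone_action \<phi> g p)) (cone_map \<iota> q) \<le> dist (V g (f p)) (f q)"
      "len g \<le> dist (V g (f p)) (f q)"
      if "g \<in> carrier G" "p \<in> infinite_cone Y" "q \<in> infinite_cone Y" for g p q
      unfolding twist[OF that(1,2)]
      by (auto simp: len_def intro!: sqrt_sum_squares_le_sum)
  qed
  show ?thesis
    using fibred_coarse_embedding_twisted
      hilbert_space_of_type[where 'v = "'h \<times> 'k \<times> real"] by metis
qed

end
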